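(* Let $X$ be a manifold and let $\mathcal{G}$ be the gauge group of a principal $G$-bundle over $X$ (a Spin bundle whose structure group is lifted to $G$). Then $\mathcal{G}$ is rationally 3-connected in each of the following cases: (i) $\dim X\le 3$ and $G$ is the rational String group $\mathrm{String}_{\mathbb{Q}}$; (ii) $\dim X\le 7$ and $G$ is the rational Fivebrane group $\mathrm{Fivebrane}_{\mathbb{Q}}$; (iii) $\dim X\le 11$ and $G$ is the rational Ninebrane group $\mathrm{Ninebrane}_{\mathbb{Q}}$.
   Context: $\mathrm{Spin}$, $\mathrm{String}$, $\mathrm{Fivebrane}$, $\mathrm{Ninebrane}$ are the successive connected covers of the stable orthogonal group $\mathrm{O}$ obtained by killing homotopy groups; their rationalizations are abelian topological groups with $\pi_i(\mathrm{String}_{\mathbb{Q}})=\mathbb{Q}$ for $i\equiv3\bmod 4$, $i\ge7$; $\pi_i(\mathrm{Fivebrane}_{\mathbb{Q}})=\mathbb{Q}$ for $i\equiv3\bmod4$, $i\ge11$; $\pi_i(\mathrm{Ninebrane}_{\mathbb{Q}})=\mathbb{Q}$ for $i\equiv3\bmod4$, $i\ge15$; and all other homotopy groups zero. The gauge group of a principal $G$-bundle $P\to X$ is the topological group of $G$-equivariant homeomorphisms of $P$ covering the identity of $X$. Rationally 3-connected means that the rational homotopy groups $\pi_i^{\mathbb{Q}}(\mathcal{G})$ vanish for $0\le i\le3$. *)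

theory Defs
  imports "HOL-Analysis.Analysis" "HOL-Algebra.Bij" "HOL-Algebra.Free_Abelian_Groups"
begin

section \<open>Homotopy groups\<close>

definition cube :: "nat \<Rightarrow> (nat \<Rightarrow> real) topology" where
  "cube i = product_topology (\<lambda>_. top_of_set {0..1}) {..<i}"

definition cube_boundary :: "nat \<Rightarrow> (nat \<Rightarrow> real) set" where
  "cube_boundary i = {x \<in> topspace (cube i). \<exists>j<i. x j = 0 \<or> x j = 1}"

definition cube_maps :: "'a topology \<Rightarrow> 'a \<Rightarrow> nat \<Rightarrow> ((nat \<Rightarrow> real) \<Rightarrow> 'a) set" where
  "cube_maps T x0 i =
     {f. continuous_map (cube i) T f \<and> (\<forall>x\<in>cube_boundary i. f x = x0)}"

definition cube_homotopic ::
    "'a topology \<Rightarrow> 'a \<Rightarrow> nat \<Rightarrow> ((nat \<Rightarrow> real) \<Rightarrow> 'a) \<Rightarrow> ((nat \<Rightarrow> real) \<Rightarrow> 'a) \<Rightarrow> bool" where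
  "cube_homotopic T x0 i f g \<longleftrightarrow>
     homotopic_with (\<lambda>h. \<forall>x\<in>cube_boundary i. h x = x0) (cube i) T f g"

text \<open>Functions that agree on the cube are homotopic, so a class does not depend on the
  (irrelevant) values of its representatives outside the cube.\<close>

definition cube_class ::
    "'a topology \<Rightarrow> 'a \<Rightarrow> nat \<Rightarrow> ((nat \<Rightarrow> real) \<Rightarrow> 'a) \<Rightarrow> ((nat \<Rightarrow> real) \<Rightarrow> 'a) set" where
  "cube_class T x0 i f = {g. cube_homotopic T x0 i f g}"

definition cube_concat ::
    "((nat \<Rightarrow> real) \<Rightarrow> 'a) \<Rightarrow> ((nat \<Rightarrow> real) \<Rightarrow> 'a) \<Rightarrow> (nat \<Rightarrow> real) \<Rightarrow> 'a" where
  "cube_concat f g x = (if x 0 \<le> 1/2 then f (x(0 := 2 * x 0)) else g (x(0 := 2 * x 0 - 1)))"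

text \<open>The homotopy group of a pointed space; to be used in degrees \<open>i \<ge> 1\<close> only.\<close>

definition homotopy_group ::
    "'a topology \<Rightarrow> 'a \<Rightarrow> nat \<Rightarrow> ((nat \<Rightarrow> real) \<Rightarrow> 'a) set monoid" where
  "homotopy_group T x0 i =
     \<lparr>carrier = cube_class T x0 i ` cube_maps T x0 i,
      monoid.mult = (\<lambda>A B. \<Union>f\<in>A. \<Union>g\<in>B. cube_class T x0 i (cube_concat f g)),
      one = cube_class T x0 i (\<lambda>_. x0)\<rparr>"

definition induced_map ::
    "'b topology \<Rightarrow> 'b \<Rightarrow> nat \<Rightarrow> ('a \<Rightarrow> 'b) \<Rightarrow> ((nat \<Rightarrow> real) \<Rightarrow> 'a) set \<Rightarrow> ((nat \<Rightarrow> real) \<Rightarrow> 'b) set"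
  where "induced_map T y0 i p A = (\<Union>f\<in>A. cube_class T y0 i (p \<circ> f))"

definition k_connected :: "nat \<Rightarrow> 'a topology \<Rightarrow> 'a \<Rightarrow> bool" where
  "k_connected k S s0 \<longleftrightarrow>
     s0 \<in> topspace S \<and> path_connected_space S \<and>
     (\<forall>i\<in>{1..k}. trivial_group (homotopy_group S s0 i))"


section \<open>Topological groups\<close>

definition topological_group :: "'g monoid \<Rightarrow> 'g topology \<Rightarrow> bool" where
  "topological_group G T \<longleftrightarrow>
     group G \<and> topspace T = carrier G \<and>
     continuous_map (prod_topology T T) T (\<lambda>(x, y). x \<otimes>\<^bsub>G\<^esub> y) \<and>
     continuous_map T T (\<lambda>x. inv\<^bsub>G\<^esub> x)"

text \<open>Based at the identity. In degree 0 the cube is a point and the group structure on the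
  path components comes from the multiplication of the topological group.\<close>

definition group_pi :: "'g monoid \<Rightarrow> 'g topology \<Rightarrow> nat \<Rightarrow> ((nat \<Rightarrow> real) \<Rightarrow> 'g) set monoid" where
  "group_pi G T i =
     (if i = 0 then
        \<lparr>carrier = cube_class T \<one>\<^bsub>G\<^esub> 0 ` cube_maps T \<one>\<^bsub>G\<^esub> 0,
         monoid.mult = (\<lambda>A B. \<Union>f\<in>A. \<Union>g\<in>B. cube_class T \<one>\<^bsub>G\<^esub> 0 (\<lambda>x. f x \<otimes>\<^bsub>G\<^esub> g x)),
         one = cube_class T \<one>\<^bsub>G\<^esub> 0 (\<lambda>_. \<one>\<^bsub>G\<^esub>)\<rparr>
      else homotopy_group T \<one>\<^bsub>G\<^esub> i)"


section \<open>Tensor products of abelian groups and rational homotopy groups\<close>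

definition tensor_relators ::
    "('a, 'c) monoid_scheme \<Rightarrow> ('b, 'd) monoid_scheme \<Rightarrow> ('a \<times> 'b \<Rightarrow>\<^sub>0 int) set" where
  "tensor_relators A B =
     {frag_of (a \<otimes>\<^bsub>A\<^esub> a', b) - frag_of (a, b) - frag_of (a', b) | a a' b.
        a \<in> carrier A \<and> a' \<in> carrier A \<and> b \<in> carrier B} \<union>
     {frag_of (a, b \<otimes>\<^bsub>B\<^esub> b') - frag_of (a, b) - frag_of (a, b') | a b b'.
        a \<in> carrier A \<and> b \<in> carrier B \<and> b' \<in> carrier B}"

definition tensor_kernel ::
    "('a, 'c) monoid_scheme \<Rightarrow> ('b, 'd) monoid_scheme \<Rightarrow> ('a \<times> 'b \<Rightarrow>\<^sub>0 int) set" where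
  "tensor_kernel A B =
     generate (free_Abelian_group (carrier A \<times> carrier B)) (tensor_relators A B)"

definition tensor_product ::
    "('a, 'c) monoid_scheme \<Rightarrow> ('b, 'd) monoid_scheme \<Rightarrow> ('a \<times> 'b \<Rightarrow>\<^sub>0 int) set monoid" where
  "tensor_product A B = free_Abelian_group (carrier A \<times> carrier B) Mod tensor_kernel A B"

definition pure_tensor ::
    "('a, 'c) monoid_scheme \<Rightarrow> ('b, 'd) monoid_scheme \<Rightarrow> 'a \<Rightarrow> 'b \<Rightarrow> ('a \<times> 'b \<Rightarrow>\<^sub>0 int) set" where
  "pure_tensor A B a b =
     tensor_kernel A B #>\<^bsub>free_Abelian_group (carrier A \<times> carrier B)\<^esub> frag_of (a, b)"

definition rat_group :: "rat monoid" where
  "rat_group = \<lparr>carrier = UNIV, monoid.mult = (+), one = 0\<rparr>"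

definition rationally_connected :: "nat \<Rightarrow> 'g monoid \<Rightarrow> 'g topology \<Rightarrow> bool" where
  "rationally_connected m G T \<longleftrightarrow>
     (\<forall>i\<le>m. trivial_group (tensor_product (group_pi G T i) rat_group))"


section \<open>The stable orthogonal group\<close>

text \<open>\<open>O(n)\<close>, embedded in the infinite matrices by \<open>A \<mapsto> A \<oplus> 1\<close>. The type
  \<open>nat \<Rightarrow> nat \<Rightarrow> real\<close> carries the topology of entrywise convergence.\<close>

definition orthogonal_matrices :: "nat \<Rightarrow> (nat \<Rightarrow> nat \<Rightarrow> real) set" where
  "orthogonal_matrices n =
     {A. (\<forall>i j. n \<le> i \<or> n \<le> j \<longrightarrow> A i j = of_bool (i = j)) \<and>
         (\<forall>i<n. \<forall>j<n. (\<Sum>k<n. A k i * A k j) = of_bool (i = j))}"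

text \<open>The colimit topology on \<open>\<Union>n. O(n)\<close>.\<close>

definition stable_orthogonal :: "(nat \<Rightarrow> nat \<Rightarrow> real) topology" where
  "stable_orthogonal =
     topology (\<lambda>U. U \<subseteq> (\<Union>n. orthogonal_matrices n) \<and>
       (\<forall>n. openin (top_of_set (orthogonal_matrices n)) (U \<inter> orthogonal_matrices n)))"

lemma openin_stable_orthogonal:
  "openin stable_orthogonal U \<longleftrightarrow>
     U \<subseteq> (\<Union>n. orthogonal_matrices n) \<and>
     (\<forall>n. openin (top_of_set (orthogonal_matrices n)) (U \<inter> orthogonal_matrices n))"
proof -
  let ?L = "\<lambda>U. U \<subseteq> (\<Union>n. orthogonal_matrices n) \<and>
    (\<forall>n. openin (top_of_set (orthogonal_matrices n)) (U \<inter> orthogonal_matrices n))"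
  have Int: "?L (A \<inter> B)" if A: "?L A" and B: "?L B" for A B
  proof (intro conjI allI)
    show "A \<inter> B \<subseteq> (\<Union>n. orthogonal_matrices n)"
      using A by blast
  next
    fix n
    have "openin (top_of_set (orthogonal_matrices n))
        ((A \<inter> orthogonal_matrices n) \<inter> (B \<inter> orthogonal_matrices n))"
      by (rule openin_Int) (use A B in blast)+
    moreover have "(A \<inter> orthogonal_matrices n) \<inter> (B \<inter> orthogonal_matrices n) =
        A \<inter> B \<inter> orthogonal_matrices n"
      by blast
    ultimately show "openin (top_of_set (orthogonal_matrices n)) (A \<inter> B \<inter> orthogonal_matrices n)"
      by argo
  qed
  have Un: "?L (\<Union>K)" if K: "\<And>A. A \<in> K \<Longrightarrow> ?L A" for K
  proof (intro conjI allI)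
    show "\<Union>K \<subseteq> (\<Union>n. orthogonal_matrices n)"
      using K by blast
  next
    fix n
    have "openin (top_of_set (orthogonal_matrices n)) (\<Union>A\<in>K. A \<inter> orthogonal_matrices n)"
      by (rule openin_Union) (use K in blast)
    then show "openin (top_of_set (orthogonal_matrices n)) (\<Union>K \<inter> orthogonal_matrices n)"
      by (simp only: Int_Union2)
  qed
  have "istopology ?L"
    unfolding istopology_def using Int Un by presburger
  then show ?thesis
    by (simp only: stable_orthogonal_def topology_inverse')
qed

definition stable_orthogonal_one :: "nat \<Rightarrow> nat \<Rightarrow> real" where
  "stable_orthogonal_one i j = of_bool (i = j)"


section \<open>Connected covers of \<open>O\<close> and their rationalizations\<close>

definition connected_cover ::
    "nat \<Rightarrow> 'a topology \<Rightarrow> 'a \<Rightarrow> 's topology \<Rightarrow> 's \<Rightarrow> ('s \<Rightarrow> 'a) \<Rightarrow> bool" where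
  "connected_cover k Y y0 S s0 p \<longleftrightarrow>
     k_connected k S s0 \<and> continuous_map S Y p \<and> p s0 = y0 \<and>
     (\<forall>i>k. induced_map Y y0 i p \<in> iso (homotopy_group S s0 i) (homotopy_group Y y0 i))"

definition rationalization_map ::
    "'s topology \<Rightarrow> 's \<Rightarrow> 'g topology \<Rightarrow> 'g \<Rightarrow> ('s \<Rightarrow> 'g) \<Rightarrow> bool" where
  "rationalization_map S s0 T g0 r \<longleftrightarrow>
     continuous_map S T r \<and> r s0 = g0 \<and>
     (\<forall>i\<ge>1. \<exists>h \<in> iso (tensor_product (homotopy_group S s0 i) rat_group) (homotopy_group T g0 i).
        \<forall>a \<in> carrier (homotopy_group S s0 i).
          h (pure_tensor (homotopy_group S s0 i) rat_group a 1) = induced_map T g0 i r a)"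

text \<open>The structure shared by the three rational groups: \<open>(S, s0, p)\<close> is the \<open>k\<close>-connected cover
  of \<open>O\<close> (the homotopy groups in degrees \<open>\<le> k\<close> are killed), \<open>r\<close> is a rationalization of \<open>S\<close>, and its
  target is an abelian topological group with the standard rational homotopy groups. The cover is
  only required to be a pointed space, and \<open>p\<close>, \<open>r\<close> need not be strict homomorphisms.\<close>

definition rational_cover_group ::
    "nat \<Rightarrow> 's topology \<Rightarrow> 's \<Rightarrow> ('s \<Rightarrow> nat \<Rightarrow> nat \<Rightarrow> real) \<Rightarrow> ('s \<Rightarrow> 'g) \<Rightarrow> 'g monoid \<Rightarrow> 'g topology \<Rightarrow> bool"
  where
  "rational_cover_group k S s0 p r G T \<longleftrightarrow>
     connected_cover k stable_orthogonal stable_orthogonal_one S s0 p \<and>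
     topological_group G T \<and> comm_group G \<and>
     rationalization_map S s0 T \<one>\<^bsub>G\<^esub> r \<and>
     (\<forall>i. if i mod 4 = 3 \<and> k + 4 \<le> i then group_pi G T i \<cong> rat_group
          else trivial_group (group_pi G T i))"

text \<open>String, Fivebrane and Ninebrane are obtained from \<open>O\<close> by killing the homotopy groups up to
  and including degree 3, 7 and 11, respectively.\<close>

definition rational_String where "rational_String = rational_cover_group 3"

definition rational_Fivebrane where "rational_Fivebrane = rational_cover_group 7"

definition rational_Ninebrane where "rational_Ninebrane = rational_cover_group 11"


section \<open>Manifolds, principal bundles and gauge groups\<close>

definition topological_manifold :: "nat \<Rightarrow> 'x topology \<Rightarrow> bool" where
  "topological_manifold n X \<longleftrightarrow>
     Hausdorff_space X \<and>
     (\<exists>B. countable B \<and> (\<forall>U\<in>B. openin X U) \<and>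
        (\<forall>W x. openin X W \<and> x \<in> W \<longrightarrow> (\<exists>U\<in>B. x \<in> U \<and> U \<subseteq> W))) \<and>
     (\<forall>x\<in>topspace X. \<exists>U V. openin X U \<and> x \<in> U \<and> openin (Euclidean_space n) V \<and>
        subtopology X U homeomorphic_space subtopology (Euclidean_space n) V)"

text \<open>\<open>act p g\<close> is the right action of \<open>g\<close> on \<open>p\<close>; the last clause gives equivariant local
  trivializations over \<open>U\<close>.\<close>

definition principal_bundle ::
    "'g monoid \<Rightarrow> 'g topology \<Rightarrow> 'p topology \<Rightarrow> 'x topology \<Rightarrow> ('p \<Rightarrow> 'x) \<Rightarrow> ('p \<Rightarrow> 'g \<Rightarrow> 'p) \<Rightarrow> bool"
  where
  "principal_bundle G T P X \<pi> act \<longleftrightarrow>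
     topological_group G T \<and>
     continuous_map P X \<pi> \<and>
     continuous_map (prod_topology P T) P (\<lambda>(p, g). act p g) \<and>
     (\<forall>p\<in>topspace P. act p \<one>\<^bsub>G\<^esub> = p) \<and>
     (\<forall>p\<in>topspace P. \<forall>g\<in>carrier G. \<forall>h\<in>carrier G. act (act p g) h = act p (g \<otimes>\<^bsub>G\<^esub> h)) \<and>
     (\<forall>p\<in>topspace P. \<forall>g\<in>carrier G. \<pi> (act p g) = \<pi> p) \<and>
     (\<forall>x\<in>topspace X. \<exists>U \<phi>. openin X U \<and> x \<in> U \<and>
        homeomorphic_map (prod_topology (subtopology X U) T)
          (subtopology P {p \<in> topspace P. \<pi> p \<in> U}) \<phi> \<and>
        (\<forall>u\<in>U. \<forall>g\<in>carrier G. \<pi> (\<phi> (u, g)) = u \<and>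
           (\<forall>h\<in>carrier G. act (\<phi> (u, g)) h = \<phi> (u, g \<otimes>\<^bsub>G\<^esub> h))))"

text \<open>Maps are represented extensionally, as in \<open>BijGroup\<close>.\<close>

definition compact_open_topology :: "'a topology \<Rightarrow> 'b topology \<Rightarrow> ('a \<Rightarrow> 'b) topology" where
  "compact_open_topology X Y =
     topology_generated_by
       {{f \<in> extensional (topspace X). continuous_map X Y f \<and> f ` K \<subseteq> U} | K U.
          compactin X K \<and> openin Y U}"

definition gauge_group ::
    "'g monoid \<Rightarrow> 'p topology \<Rightarrow> ('p \<Rightarrow> 'x) \<Rightarrow> ('p \<Rightarrow> 'g \<Rightarrow> 'p) \<Rightarrow> ('p \<Rightarrow> 'p) monoid" where
  "gauge_group G P \<pi> act =
     (BijGroup (topspace P))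
       \<lparr>carrier := {f \<in> extensional (topspace P). homeomorphic_map P P f \<and>
          (\<forall>p\<in>topspace P. \<pi> (f p) = \<pi> p \<and> (\<forall>g\<in>carrier G. f (act p g) = act (f p) g))}\<rparr>"

definition gauge_topology ::
    "'g monoid \<Rightarrow> 'p topology \<Rightarrow> ('p \<Rightarrow> 'x) \<Rightarrow> ('p \<Rightarrow> 'g \<Rightarrow> 'p) \<Rightarrow> ('p \<Rightarrow> 'p) topology" where
  "gauge_topology G P \<pi> act =
     subtopology (compact_open_topology P P) (carrier (gauge_group G P \<pi> act))"

end

theory Submission
  imports Defs
begin

text \<open>Because \<open>G\<close> is abelian, a gauge transformation is right translation by a continuous map
  \<open>X \<rightarrow> G\<close>, so a map from the \<open>i\<close>-cube to the gauge group is the same as a map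
  \<open>F\<close> from \<open>I\<^sup>i \<times> X\<close> to \<open>G\<close>, equal to \<open>1\<close> over the boundary of the cube. A nullhomotopy of \<open>F\<close> is built
  over one chart at a time: in a coordinate cube, subdivided by a grid so fine that every small cube
  meeting the closed set already treated lies in the domain of the given nullhomotopy, the nullhomotopy is
  extended cell by cell. The cells of \<open>I\<^sup>i \<times> [0,1]\<^sup>n\<close> have dimension at most \<open>i + n\<close>, and the homotopy groups
  of \<open>G\<close> vanish up to dimension \<open>3 + n\<close>. As \<open>F\<close> itself never changes, countably many such
  extensions have a well-defined union.\<close>

section \<open>Nullhomotopies of maps on cubes\<close>

text \<open>A topological manifold need not carry a triangulation, so there is no global skeleton to
  induct over: cells exist only inside a chart, and the grids of two charts are unrelated. Hence
  each step keeps the nullhomotopy only on a closed set \<open>C\<close> and may give it up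
  elsewhere on its open domain; this slack is what lets a grid of the new chart separate
  \<open>C\<close> from the region where nothing is known. The dimension bounds come from degrees:
  with \<open>n \<le> k\<close> and cubes of dimension \<open>i \<le> 3\<close>, cells have
  dimension at most \<open>k + 3\<close>, one below the first degree \<open>k + 4\<close> in which
  \<open>G\<close> has a nonzero homotopy group. So the homotopy of the gauge group is trivial in
  these degrees even before tensoring with the rationals. The bundle may be nontrivial: right
  translation by an element is equivariant as soon as that element commutes with the structure
  group, and this gives a global description by maps from \<open>X\<close> without a global
  section.\<close>

lemma continuous_map_paste_closed:
  assumes "closedin X A" "closedin X B" "topspace X \<subseteq> A \<union> B"
    and "continuous_map (subtopology X A) Y f" "continuous_map (subtopology X B) Y g"
    and "\<And>x. x \<in> A \<Longrightarrow> x \<in> B \<Longrightarrow> f x = g x"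
  shows "continuous_map X Y (\<lambda>x. if x \<in> A then f x else g x)"
  by (rule pasting_lemma_closed[where I = UNIV and T = "\<lambda>b. if b then A else B"
        and f = "\<lambda>b. if b then f else g"])
    (use assms in \<open>auto split: if_splits\<close>)

lemma continuous_map_paste_open:
  assumes "openin X A" "openin X B" "topspace X \<subseteq> A \<union> B"
    and "continuous_map (subtopology X A) Y f" "continuous_map (subtopology X B) Y g"
    and "\<And>x. x \<in> A \<Longrightarrow> x \<in> B \<Longrightarrow> f x = g x"
  shows "continuous_map X Y (\<lambda>x. if x \<in> A then f x else g x)"
  by (rule pasting_lemma[where I = UNIV and T = "\<lambda>b. if b then A else B"
        and f = "\<lambda>b. if b then f else g"])
    (use assms in \<open>auto split: if_splits\<close>)

lemma continuous_map_group_mult: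
  assumes "topological_group G T" "continuous_map X T f" "continuous_map X T g"
  shows "continuous_map X T (\<lambda>x. f x \<otimes>\<^bsub>G\<^esub> g x)"
proof -
  have "continuous_map X (prod_topology T T) (\<lambda>x. (f x, g x))"
    using assms by (simp add: continuous_map_paired)
  moreover have "continuous_map (prod_topology T T) T (\<lambda>(x, y). x \<otimes>\<^bsub>G\<^esub> y)"
    using assms by (simp add: topological_group_def)
  ultimately have "continuous_map X T ((\<lambda>(x, y). x \<otimes>\<^bsub>G\<^esub> y) \<circ> (\<lambda>x. (f x, g x)))"
    by (rule continuous_map_compose)
  then show ?thesis by (simp add: o_def)
qed

lemma continuous_map_group_inv:
  assumes "topological_group G T" "continuous_map X T f"
  shows "continuous_map X T (\<lambda>x. inv\<^bsub>G\<^esub> (f x))"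
proof -
  have "continuous_map X T ((\<lambda>x. inv\<^bsub>G\<^esub> x) \<circ> f)"
    using assms by (intro continuous_map_compose) (auto simp: topological_group_def)
  then show ?thesis by (simp add: o_def)
qed

text \<open>The contraction is read backwards, from the constant at time 0 to \<open>F\<close> at
  time 1. Only \<open>k\<close> depends on the domain reached so far, so an extension never has to
  alter the map being contracted.\<close>

definition nullhomotopy :: "'a topology \<Rightarrow> 'b topology \<Rightarrow> 'b \<Rightarrow> ('a \<Rightarrow> 'b) \<Rightarrow> ('a \<times> real \<Rightarrow> 'b) \<Rightarrow> bool"
  where "nullhomotopy S T e F k \<longleftrightarrow>
    continuous_map (prod_topology S (top_of_set {0..1})) T k \<and>
    (\<forall>x\<in>topspace S. k (x, 0) = e \<and> k (x, 1) = F x)"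

section \<open>Classes of cube maps and nullhomotopies\<close>

lemma topspace_cube: "topspace (cube m) = {..<m} \<rightarrow>\<^sub>E {0..1}"
  by (simp add: cube_def)

text \<open>The rule for \<open>homotopic_with\<close> needs a side condition that depends only on
  values on the cube; this one does, because the boundary is part of the cube.\<close>

lemma cube_homotopic_iff:
  "cube_homotopic T e m f g \<longleftrightarrow>
    (\<exists>h. continuous_map (prod_topology (top_of_set {0..1::real}) (cube m)) T h \<and>
      (\<forall>x\<in>topspace (cube m). h (0, x) = f x) \<and> (\<forall>x\<in>topspace (cube m). h (1, x) = g x) \<and>
      (\<forall>t\<in>{0..1}. \<forall>x\<in>cube_boundary m. h (t, x) = e))"
  unfolding cube_homotopic_def
  by (rule homotopic_with) (auto simp: cube_boundary_def)

lemma cube_homotopic_refl: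
  assumes "f \<in> cube_maps T e m"
  shows "cube_homotopic T e m f f"
  using assms by (simp add: cube_homotopic_def cube_maps_def homotopic_with_refl)

lemma cube_homotopic_sym: "cube_homotopic T e m f g \<Longrightarrow> cube_homotopic T e m g f"
  unfolding cube_homotopic_def by (rule homotopic_with_sym[THEN iffD1])

lemma cube_homotopic_trans:
  "cube_homotopic T e m f g \<Longrightarrow> cube_homotopic T e m g h \<Longrightarrow> cube_homotopic T e m f h"
  unfolding cube_homotopic_def by (rule homotopic_with_trans)

lemma cube_class_eqI: "cube_homotopic T e m f g \<Longrightarrow> cube_class T e m f = cube_class T e m g"
  unfolding cube_class_def using cube_homotopic_sym cube_homotopic_trans by fast

text \<open>Time is the first coordinate in \<open>homotopic_with\<close> and the second in
  \<open>nullhomotopy\<close>, so the homotopy is composed with the swap.\<close>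

lemma cube_homotopic_const_imp_nullhomotopy:
  assumes "cube_homotopic T e m (\<lambda>_. e) f"
  obtains h where "nullhomotopy (cube m) T e f h"
    "\<And>x t. x \<in> cube_boundary m \<Longrightarrow> t \<in> {0..1} \<Longrightarrow> h (x, t) = e"
proof -
  obtain h where h: "continuous_map (prod_topology (top_of_set {0..1::real}) (cube m)) T h"
    "\<And>x. x \<in> topspace (cube m) \<Longrightarrow> h (0, x) = e" "\<And>x. x \<in> topspace (cube m) \<Longrightarrow> h (1, x) = f x"
    "\<And>t x. t \<in> {0..1} \<Longrightarrow> x \<in> cube_boundary m \<Longrightarrow> h (t, x) = e"
    using assms unfolding cube_homotopic_iff by metis
  have "continuous_map (prod_topology (cube m) (top_of_set {0..1::real})) T (h \<circ> (\<lambda>(x, t). (t, x)))"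
    by (rule continuous_map_compose[OF _ h(1)])
      (simp add: case_prod_unfold continuous_map_paired continuous_map_fst continuous_map_snd)
  then show ?thesis
    using h by (intro that[of "h \<circ> (\<lambda>(x, t). (t, x))"]) (auto simp: nullhomotopy_def)
qed

lemma nullhomotopy_imp_cube_homotopic_const:
  assumes "nullhomotopy (cube m) T e f h"
    "\<And>x t. x \<in> cube_boundary m \<Longrightarrow> t \<in> {0..1} \<Longrightarrow> h (x, t) = e"
  shows "cube_homotopic T e m (\<lambda>_. e) f"
proof -
  have "continuous_map (prod_topology (top_of_set {0..1::real}) (cube m)) T (h \<circ> (\<lambda>(t, x). (x, t)))"
    by (rule continuous_map_compose[of _ "prod_topology (cube m) (top_of_set {0..1})"])
      (use assms in \<open>simp_all add: nullhomotopy_def case_prod_unfold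
        continuous_map_paired continuous_map_fst continuous_map_snd\<close>)
  then show ?thesis
    unfolding cube_homotopic_iff using assms
    by (intro exI[of _ "h \<circ> (\<lambda>(t, x). (x, t))"]) (auto simp: nullhomotopy_def)
qed

text \<open>The two branches of \<open>group_pi\<close> differ only in the multiplication, so degree
  0 needs no separate treatment when triviality is used.\<close>

lemma carrier_group_pi:
  "carrier (group_pi G T m) = cube_class T \<one>\<^bsub>G\<^esub> m ` cube_maps T \<one>\<^bsub>G\<^esub> m"
  by (simp add: group_pi_def homotopy_group_def)

lemma one_group_pi: "\<one>\<^bsub>group_pi G T m\<^esub> = cube_class T \<one>\<^bsub>G\<^esub> m (\<lambda>_. \<one>\<^bsub>G\<^esub>)"
  by (simp add: group_pi_def homotopy_group_def)

text \<open>All classes coincide with that of the constant map, and by reflexivity \<open>f\<close>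
  belongs to its own class.\<close>

lemma trivial_group_pi_cube_homotopic:
  assumes "trivial_group (group_pi G T m)" "f \<in> cube_maps T \<one>\<^bsub>G\<^esub> m"
  shows "cube_homotopic T \<one>\<^bsub>G\<^esub> m (\<lambda>_. \<one>\<^bsub>G\<^esub>) f"
proof -
  have "cube_class T \<one>\<^bsub>G\<^esub> m f = cube_class T \<one>\<^bsub>G\<^esub> m (\<lambda>_. \<one>\<^bsub>G\<^esub>)"
    using assms unfolding trivial_group_def carrier_group_pi one_group_pi by blast
  moreover have "f \<in> cube_class T \<one>\<^bsub>G\<^esub> m f"
    using cube_homotopic_refl[OF assms(2)] by (simp add: cube_class_def)
  ultimately show ?thesis by (simp add: cube_class_def)
qed

section \<open>Extension over cells\<close>

text \<open>The inserted 0 makes the maximum meaningful for \<open>J = {}\<close>, the case of a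
  cell of dimension 0.\<close>

definition max_norm :: "'a set \<Rightarrow> ('a \<Rightarrow> real) \<Rightarrow> real" where
  "max_norm J v = Max (insert 0 ((\<lambda>j. \<bar>v j\<bar>) ` J))"

lemma max_norm_ge: "finite J \<Longrightarrow> j \<in> J \<Longrightarrow> \<bar>v j\<bar> \<le> max_norm J v"
  unfolding max_norm_def by (intro Max_ge) auto

lemma max_norm_le_iff: "finite J \<Longrightarrow> 0 \<le> a \<Longrightarrow> max_norm J v \<le> a \<longleftrightarrow> (\<forall>j\<in>J. \<bar>v j\<bar> \<le> a)"
  unfolding max_norm_def by (subst Max_le_iff) auto

lemma max_norm_attained:
  assumes "finite J" "0 < max_norm J v"
  obtains j where "j \<in> J" "max_norm J v = \<bar>v j\<bar>"
proof -
  have "max_norm J v \<in> insert 0 ((\<lambda>j. \<bar>v j\<bar>) ` J)"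
    unfolding max_norm_def using assms(1) by (intro Max_in) auto
  then show ?thesis using assms(2) that by auto
qed

lemma continuous_on_max_norm [continuous_intros]:
  assumes "finite J" "\<And>j. j \<in> J \<Longrightarrow> continuous_on S (\<lambda>x. v x j)"
  shows "continuous_on S (\<lambda>x. max_norm J (v x))"
  using assms
proof (induction J)
  case empty
  then show ?case by (simp add: max_norm_def)
next
  case (insert j J)
  have "max_norm (insert j J) w = max \<bar>w j\<bar> (max_norm J w)" for w :: "'a \<Rightarrow> real"
    unfolding max_norm_def image_insert
    by (subst insert_commute, rule Max_insert) (use insert.hyps(1) in auto)
  then show ?case
    using insert by (auto intro!: continuous_intros)
qed

text \<open>The group structure of the target replaces the homotopy extension property: after dividing by an
  arbitrary extension of the boundary nullhomotopy, the remaining map is \<open>1\<close> on the boundary.\<close>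

lemma cell_extension:
  fixes lo :: "nat \<Rightarrow> real" and J :: "nat set"
  defines "e \<equiv> {y. \<forall>j. lo j \<le> y j \<and> y j \<le> lo j + of_bool (j \<in> J)}"
  defines "b \<equiv> {y \<in> e. \<exists>j\<in>J. y j = lo j \<or> y j = lo j + 1}"
  assumes G: "topological_group G T" and J: "finite J" and pi: "trivial_group (group_pi G T (card J))"
    and F: "continuous_map (top_of_set e) T F"
    and k: "nullhomotopy (top_of_set b) T \<one>\<^bsub>G\<^esub> F k"
  obtains k' where "nullhomotopy (top_of_set e) T \<one>\<^bsub>G\<^esub> F k'"
    "\<And>x t. x \<in> b \<Longrightarrow> t \<in> {0..1} \<Longrightarrow> k' (x, t) = k (x, t)"
proof -
  interpret group G using G by (simp add: topological_group_def)
  have topT: "topspace T = carrier G" using G by (simp add: topological_group_def)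
  define I where "I = {0..1::real}"
  \<comment> \<open>\<open>c\<close> is the centre of the cell. The factor 2 in \<open>s\<close>
    normalizes the half-width 1/2, so \<open>s\<close> grows from 0 at the centre to 1 on the
    boundary, and \<open>r\<close> is the radial projection away from the centre.\<close>
  define c where "c j = lo j + of_bool (j \<in> J) / 2" for j
  define s where "s y = max_norm J (\<lambda>j. 2 * (y j - c j))" for y
  define r where "r y = (\<lambda>j. c j + (y j - c j) / s y)" for y
  have cont_coord: "continuous_on S (\<lambda>y. y j)" for S :: "(nat \<Rightarrow> real) set" and j
    by (rule continuous_on_product_then_coordinatewise) (rule continuous_on_id)
  have cont_s: "continuous_on S s" for S
    unfolding s_def by (intro continuous_intros J cont_coord)
  have s_ge0: "0 \<le> s y" for y
    unfolding s_def max_norm_def using J by (intro Max_ge) auto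
  have s_le1: "s y \<le> 1" if "y \<in> e" for y
    unfolding s_def using J
  proof (subst max_norm_le_iff; safe?)
    fix j assume "j \<in> J"
    then show "\<bar>2 * (y j - c j)\<bar> \<le> 1"
      using that unfolding e_def c_def by (auto simp: abs_le_iff dest!: spec[of _ j])
  qed auto
  have s_b: "s y = 1" if y: "y \<in> b" for y
  proof -
    obtain j where j: "j \<in> J" "y j = lo j \<or> y j = lo j + 1" using y unfolding b_def by auto
    have "1 \<le> s y"
      using max_norm_ge[OF J j(1), of "\<lambda>j. 2 * (y j - c j)"] j unfolding s_def c_def by auto
    moreover have "y \<in> e" using y unfolding b_def by auto
    ultimately show ?thesis using s_le1 by force
  qed
  have r_b: "r y \<in> b" if y: "y \<in> e" "1/2 \<le> s y" for y
  proof -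
    have "0 < s y" using y by auto
    have *: "\<bar>r y j - c j\<bar> \<le> 1/2" if "j \<in> J" for j
    proof -
      have "2 * \<bar>y j - c j\<bar> \<le> s y"
        using max_norm_ge[OF J that, of "\<lambda>j. 2 * (y j - c j)"] unfolding s_def by (simp only: abs_mult abs_numeral)
      then show ?thesis using \<open>0 < s y\<close> by (simp add: r_def field_simps)
    qed
    have "lo j \<le> r y j \<and> r y j \<le> lo j + of_bool (j \<in> J)" for j
    proof (cases "j \<in> J")
      case True
      then have "\<bar>r y j - (lo j + 1/2)\<bar> \<le> 1/2" using *[OF True] unfolding c_def by simp
      then show ?thesis using True by (simp only: abs_le_iff) simp
    next
      case False
      then have "y j = lo j" using y(1) unfolding e_def by (auto dest!: spec[of _ j])
      then show ?thesis using False by (simp add: r_def c_def)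
    qed
    then have "r y \<in> e" unfolding e_def by blast
    moreover obtain j where j: "j \<in> J" "s y = \<bar>2 * (y j - c j)\<bar>"
      using max_norm_attained[OF J, of "\<lambda>j. 2 * (y j - c j)"] \<open>0 < s y\<close> unfolding s_def by metis
    have "\<bar>r y j - c j\<bar> = 1/2"
      using j(2)[unfolded abs_mult abs_numeral] \<open>0 < s y\<close> by (simp add: r_def abs_divide)
    then have "r y j = lo j \<or> r y j = lo j + 1"
      using j(1) unfolding c_def by (auto simp: abs_if split: if_splits)
    ultimately show ?thesis using j(1) unfolding b_def by blast
  qed
  have r_id: "r y = y" if "y \<in> b" for y
    using s_b[OF that] by (simp add: r_def)
  have kc: "continuous_map (top_of_set (b \<times> I)) T k"
    and k0: "\<And>x. x \<in> b \<Longrightarrow> k (x, 0) = \<one>\<^bsub>G\<^esub>" and k1: "\<And>x. x \<in> b \<Longrightarrow> k (x, 1) = F x"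
    using k unfolding nullhomotopy_def I_def prod_topology_subtopology_eu by auto

  \<comment> \<open>\<open>kk\<close> is the given nullhomotopy, coned off towards the centre of the cell\<close>
  define A where "A = {z \<in> e \<times> I. 1/2 \<le> s (fst z)}"
  define B where "B = {z \<in> e \<times> I. s (fst z) \<le> 1/2}"
  \<comment> \<open>The time factor falls from 1 on the boundary to 0 at \<open>s = 1/2\<close>,
    where \<open>k\<close> is evaluated at time 0 and equals 1. So the constant 1 continues it over
    the core, and \<open>r\<close> is used only away from the centre, where it is singular.\<close>
  define q where "q z = (r (fst z), snd z * (2 * s (fst z) - 1))" for z :: "(nat \<Rightarrow> real) \<times> real"
  define kk where "kk z = (if z \<in> A then k (q z) else \<one>\<^bsub>G\<^esub>)" for z
  have cont_sf: "continuous_on S (\<lambda>z. s (fst z))" for S :: "((nat \<Rightarrow> real) \<times> real) set"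
    by (rule continuous_on_compose2[OF cont_s[of UNIV]]) (auto intro: continuous_intros)
  have cont_fst: "continuous_on S (\<lambda>z. fst z j)" for S :: "((nat \<Rightarrow> real) \<times> real) set" and j
    by (rule continuous_on_product_then_coordinatewise) (intro continuous_intros)
  have q_mem: "q z \<in> b \<times> I" if z: "z \<in> A" for z
  proof -
    have "snd z \<in> {0..1}" "fst z \<in> e" "1/2 \<le> s (fst z)"
      using z by (auto simp: A_def I_def)
    moreover have "snd z * (2 * s (fst z) - 1) \<le> 1 * 1"
      using s_le1[of "fst z"] calculation by (intro mult_mono) auto
    ultimately show ?thesis using r_b[of "fst z"] by (auto simp: q_def I_def)
  qed
  have "continuous_on A q"
    unfolding q_def r_def
    by (intro continuous_on_Pair continuous_on_coordinatewise_then_product continuous_intros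
          cont_sf cont_fst) (auto simp: A_def)
  then have "continuous_map (top_of_set A) (top_of_set (b \<times> I)) q"
    using q_mem by (auto simp: continuous_map_subtopology_eu)
  from continuous_map_compose[OF this kc]
  have kq: "continuous_map (top_of_set A) T (\<lambda>z. k (q z))" by (simp add: o_def)
  have kkc: "continuous_map (top_of_set (e \<times> I)) T kk"
    unfolding kk_def
  proof (rule continuous_map_paste_closed)
    have "closedin (top_of_set (e \<times> I)) ((e \<times> I) \<inter> (\<lambda>z. s (fst z)) -` {1/2..})"
      by (intro continuous_closedin_preimage cont_sf) auto
    then show "closedin (top_of_set (e \<times> I)) A"
      by (rule back_subst[of "closedin _"]) (auto simp: A_def)
    have "closedin (top_of_set (e \<times> I)) ((e \<times> I) \<inter> (\<lambda>z. s (fst z)) -` {..1/2})"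
      by (intro continuous_closedin_preimage cont_sf) auto
    then show "closedin (top_of_set (e \<times> I)) B"
      by (rule back_subst[of "closedin _"]) (auto simp: B_def)
    show "topspace (top_of_set (e \<times> I)) \<subseteq> A \<union> B"
      by (auto simp: A_def B_def)
    have "(e \<times> I) \<inter> A = A" by (auto simp: A_def)
    then show "continuous_map (subtopology (top_of_set (e \<times> I)) A) T (\<lambda>z. k (q z))"
      using kq by (simp add: subtopology_subtopology)
    show "continuous_map (subtopology (top_of_set (e \<times> I)) B) T (\<lambda>_. \<one>\<^bsub>G\<^esub>)"
      by (simp add: topT)
    fix z assume z: "z \<in> A" "z \<in> B"
    then have "s (fst z) = 1/2" by (auto simp: A_def B_def)
    then have "q z = (r (fst z), 0)" by (simp add: q_def)
    then show "k (q z) = \<one>\<^bsub>G\<^esub>"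
      using k0[of "r (fst z)"] r_b[of "fst z"] z by (auto simp: A_def)
  qed
  have kk0: "kk (y, 0) = \<one>\<^bsub>G\<^esub>" if "y \<in> e" for y
    using that k0[OF r_b[of y]] by (auto simp: kk_def A_def q_def)
  have kkb: "kk (y, t) = k (y, t)" if "y \<in> b" "t \<in> I" for y t
    using that s_b[of y] r_id[of y] by (auto simp: kk_def A_def q_def b_def)
  have kk_carrier: "kk z \<in> carrier G" if "z \<in> e \<times> I" for z
    using continuous_map_image_subset_topspace[OF kkc] that topT by auto
  have F_carrier: "F y \<in> carrier G" if "y \<in> e" for y
    using continuous_map_image_subset_topspace[OF F] that topT by auto

  \<comment> \<open>Enumerating \<open>J\<close> identifies the cell with the cube of dimension
    \<open>card J\<close>: \<open>u\<close> maps the cube to the cell and \<open>v\<close> goes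
    back, restricted because points of the cube are extensional.\<close>
  obtain \<sigma> where \<sigma>: "bij_betw \<sigma> {..<card J} J"
    using ex_bij_betw_nat_finite[OF J] by (auto simp: atLeast0LessThan)
  define \<tau> where "\<tau> = inv_into {..<card J} \<sigma>"
  have \<tau>: "\<tau> j < card J" "\<sigma> (\<tau> j) = j" if "j \<in> J" for j
    using that \<sigma> unfolding \<tau>_def
    by (metis bij_betw_def inv_into_into lessThan_iff, metis bij_betw_inv_into_right)
  have \<sigma>': "\<sigma> i \<in> J" "\<tau> (\<sigma> i) = i" if "i < card J" for i
    using that \<sigma> unfolding \<tau>_def
    by (metis bij_betwE lessThan_iff, metis bij_betw_inv_into_left lessThan_iff)
  define u where "u w = (\<lambda>j. if j \<in> J then lo j + w (\<tau> j) else lo j)" for w :: "nat \<Rightarrow> real"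
  define v where "v y = (\<lambda>i\<in>{..<card J}. y (\<sigma> i) - lo (\<sigma> i))" for y :: "nat \<Rightarrow> real"
  have u_e: "u w \<in> e" if "w \<in> topspace (cube (card J))" for w
    using that \<tau> by (auto simp: topspace_cube u_def e_def PiE_iff)
  have u_b: "u w \<in> b" if w: "w \<in> cube_boundary (card J)" for w
  proof -
    obtain i where i: "i < card J" "w i = 0 \<or> w i = 1" using w by (auto simp: cube_boundary_def)
    then have "u w (\<sigma> i) = lo (\<sigma> i) \<or> u w (\<sigma> i) = lo (\<sigma> i) + 1"
      using \<sigma>' by (auto simp: u_def)
    then show ?thesis using u_e[of w] w \<sigma>'(1)[OF i(1)] by (auto simp: b_def cube_boundary_def)
  qed
  have v_cube: "v y \<in> topspace (cube (card J))" if y: "y \<in> e" for y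
  proof -
    have "lo (\<sigma> i) \<le> y (\<sigma> i) \<and> y (\<sigma> i) \<le> lo (\<sigma> i) + 1" if "i < card J" for i
      using y \<sigma>'(1)[OF that] unfolding e_def by (auto dest: spec[of _ "\<sigma> i"])
    then have "y (\<sigma> i) - lo (\<sigma> i) \<in> {0..1}" if "i < card J" for i
      using that by (simp add: diff_le_eq add.commute)
    then show ?thesis by (auto simp: topspace_cube v_def)
  qed
  have uv: "u (v y) = y" if "y \<in> e" for y
  proof
    fix j show "u (v y) j = y j"
      using that \<tau>[of j] by (auto simp: u_def v_def e_def dest: spec[of _ j])
  qed
  have v_b: "v y \<in> cube_boundary (card J)" if y: "y \<in> b" for y
  proof -
    obtain j where j: "j \<in> J" "y j = lo j \<or> y j = lo j + 1" using y unfolding b_def by auto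
    have "v y (\<tau> j) = y j - lo j" using \<tau>[OF j(1)] by (simp add: v_def)
    then have "v y (\<tau> j) = 0 \<or> v y (\<tau> j) = 1" using j(2) by auto
    moreover have "v y \<in> topspace (cube (card J))" using y v_cube by (simp add: b_def)
    ultimately show ?thesis using \<tau>(1)[OF j(1)] unfolding cube_boundary_def by blast
  qed
  have cont_u: "continuous_map (cube (card J)) (top_of_set e) u"
  proof -
    have "continuous_map (cube (card J)) euclideanreal (\<lambda>w. u w j)" for j
    proof (cases "j \<in> J")
      case True
      have "continuous_map (cube (card J)) (top_of_set {0..1}) (\<lambda>w. w (\<tau> j))"
        unfolding cube_def using \<tau>[OF True] by (intro continuous_map_product_projection) auto
      then have "continuous_map (cube (card J)) euclideanreal (\<lambda>w. w (\<tau> j))"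
        using continuous_map_into_fulltopology by blast
      then show ?thesis using True
        by (simp add: u_def continuous_map_add)
    qed (simp add: u_def)
    then have "continuous_map (cube (card J)) euclidean u"
      unfolding euclidean_product_topology[symmetric] continuous_map_componentwise_UNIV by blast
    then show ?thesis using u_e by (auto simp: continuous_map_in_subtopology)
  qed
  have cont_v: "continuous_map (top_of_set e) (cube (card J)) v"
    unfolding cube_def continuous_map_componentwise
  proof (intro conjI ballI)
    show "v ` topspace (top_of_set e) \<subseteq> extensional {..<card J}"
      by (auto simp: v_def)
    fix i assume i: "i \<in> {..<card J}"
    have "(\<lambda>y. v y i) = (\<lambda>y. y (\<sigma> i) - lo (\<sigma> i))"
      using i by (auto simp: v_def)
    then have "continuous_on e (\<lambda>y. v y i)"
      by (simp only:) (intro continuous_intros cont_coord)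
    moreover have "v y i \<in> {0..1}" if "y \<in> e" for y
      using v_cube[OF that] i by (auto simp: topspace_cube PiE_iff)
    ultimately show "continuous_map (top_of_set e) (top_of_set {0..1}) (\<lambda>y. v y i)"
      by (auto simp: continuous_map_subtopology_eu)
  qed

  \<comment> \<open>The quotient by the end of \<open>kk\<close> is 1 on the boundary, hence
    represents an element of the trivial group in degree \<open>card J\<close>.\<close>
  define F' where "F' y = F y \<otimes>\<^bsub>G\<^esub> inv\<^bsub>G\<^esub> (kk (y, 1))" for y
  have "continuous_map (top_of_set e) (top_of_set (e \<times> I)) (\<lambda>y. (y, 1))"
    by (auto simp: continuous_map_subtopology_eu I_def intro!: continuous_intros)
  from continuous_map_compose[OF this kkc]
  have "continuous_map (top_of_set e) T (\<lambda>y. kk (y, 1))" by (simp add: o_def)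
  then have F'c: "continuous_map (top_of_set e) T F'"
    unfolding F'_def by (intro continuous_map_group_mult[OF G] continuous_map_group_inv[OF G] F)
  have F'b: "F' y = \<one>\<^bsub>G\<^esub>" if "y \<in> b" for y
    using that kkb[of y 1] k1[of y] F_carrier[of y] by (auto simp: F'_def I_def b_def)
  have "F' \<circ> u \<in> cube_maps T \<one>\<^bsub>G\<^esub> (card J)"
    using continuous_map_compose[OF cont_u F'c] F'b u_b by (auto simp: cube_maps_def)
  then obtain h where h: "nullhomotopy (cube (card J)) T \<one>\<^bsub>G\<^esub> (F' \<circ> u) h"
    and hb: "\<And>x t. x \<in> cube_boundary (card J) \<Longrightarrow> t \<in> {0..1} \<Longrightarrow> h (x, t) = \<one>\<^bsub>G\<^esub>"
    using trivial_group_pi_cube_homotopic[OF pi] cube_homotopic_const_imp_nullhomotopy by metis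
  \<comment> \<open>Multiplying back: at time 1 the factor \<open>F'\<close> turns the end of
    \<open>kk\<close> into \<open>F\<close>, and over the boundary \<open>h\<close> is 1, which
    leaves the prescribed \<open>k\<close>.\<close>
  define k' where "k' z = h (v (fst z), snd z) \<otimes>\<^bsub>G\<^esub> kk z" for z
  have "continuous_map (prod_topology (top_of_set e) (top_of_set I))
      (prod_topology (cube (card J)) (top_of_set I)) (\<lambda>z. (v (fst z), snd z))"
    by (intro continuous_map_pairedI continuous_map_compose[OF _ cont_v, unfolded o_def]
         continuous_map_fst continuous_map_snd)
  from continuous_map_compose[OF this] h
  have "continuous_map (prod_topology (top_of_set e) (top_of_set I)) T (\<lambda>z. h (v (fst z), snd z))"
    by (fastforce simp: o_def nullhomotopy_def I_def)
  then have k'c: "continuous_map (prod_topology (top_of_set e) (top_of_set I)) T k'"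
    unfolding k'_def using kkc by (intro continuous_map_group_mult[OF G]) (simp_all add: prod_topology_subtopology_eu)
  show ?thesis
  proof
    show "nullhomotopy (top_of_set e) T \<one>\<^bsub>G\<^esub> F k'"
      unfolding nullhomotopy_def
    proof (intro conjI ballI)
      show "continuous_map (prod_topology (top_of_set e) (top_of_set {0..1})) T k'"
        using k'c by (simp add: I_def)
      fix y assume "y \<in> topspace (top_of_set e)"
      then have y: "y \<in> e" by simp
      show "k' (y, 0) = \<one>\<^bsub>G\<^esub>"
        using h v_cube[OF y] kk0[OF y] by (simp add: k'_def nullhomotopy_def)
      have "k' (y, 1) = F' y \<otimes>\<^bsub>G\<^esub> kk (y, 1)"
        using h v_cube[OF y] uv[OF y] by (simp add: k'_def nullhomotopy_def)
      then show "k' (y, 1) = F y"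
        using F_carrier[OF y] kk_carrier[of "(y, 1)"] y
        by (simp add: F'_def m_assoc I_def)
    qed
    fix y t assume y: "y \<in> b" "t \<in> {0..1::real}"
    then have "k (y, t) \<in> carrier G"
      using kkb[of y t] kk_carrier[of "(y, t)"] by (auto simp: I_def b_def)
    then show "k' (y, t) = k (y, t)"
      using y v_b[of y] kkb[of y t] hb[of "v y" t] by (simp add: k'_def I_def)
  qed
qed

section \<open>Induction over the cells of an integral grid\<close>

lemma nullhomotopy_subset:
  assumes "nullhomotopy S T e F k" "topspace S' \<subseteq> topspace S" "continuous_map S' S id"
  shows "nullhomotopy S' T e F k"
proof -
  have "continuous_map (prod_topology S' (top_of_set {0..1::real})) (prod_topology S (top_of_set {0..1})) id"
    using assms(3) continuous_map_prod_top[of S' "top_of_set {0..1::real}" S "top_of_set {0..1}" id id]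
    by (simp add: case_prod_unfold id_def)
  then have "continuous_map (prod_topology S' (top_of_set {0..1})) T (k \<circ> id)"
    using assms(1) unfolding nullhomotopy_def by (blast intro: continuous_map_compose)
  then show ?thesis
    using assms unfolding nullhomotopy_def by auto
qed

lemma nullhomotopy_top_of_set_subset:
  "nullhomotopy (top_of_set D) T e F k \<Longrightarrow> D' \<subseteq> D \<Longrightarrow> nullhomotopy (top_of_set D') T e F k"
  by (rule nullhomotopy_subset[of "top_of_set D"])
    (auto simp: continuous_map_subtopology_eu subset_iff)

text \<open>\<open>cell x\<close> is the smallest closed cell of the integer grid containing \<open>x\<close>; its dimension is the number
  of non-integral coordinates of \<open>x\<close>. A set \<open>D\<close> with \<open>cell x \<subseteq> D\<close> for all \<open>x \<in> D\<close> is a subcomplex.\<close>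

definition cell :: "(nat \<Rightarrow> real) \<Rightarrow> (nat \<Rightarrow> real) set" where
  "cell x = {y. \<forall>j. of_int \<lfloor>x j\<rfloor> \<le> y j \<and> y j \<le> of_int \<lceil>x j\<rceil>}"

lemma self_mem_cell: "x \<in> cell x"
  by (simp add: cell_def)

text \<open>The bounds of the cell of \<open>x\<close> are integers, so they pass from
  \<open>y\<close> to its floors and ceilings. Hence a closed cell is itself a subcomplex.\<close>

lemma cell_mono: "y \<in> cell x \<Longrightarrow> cell y \<subseteq> cell x"
proof
  fix z assume y: "y \<in> cell x" and z: "z \<in> cell y"
  have "of_int \<lfloor>x j\<rfloor> \<le> z j \<and> z j \<le> of_int \<lceil>x j\<rceil>" for j
  proof -
    have "\<lfloor>x j\<rfloor> \<le> \<lfloor>y j\<rfloor>" "\<lceil>y j\<rceil> \<le> \<lceil>x j\<rceil>"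
      using y by (auto simp: cell_def le_floor_iff ceiling_le_iff)
    then have "real_of_int \<lfloor>x j\<rfloor> \<le> of_int \<lfloor>y j\<rfloor>" "real_of_int \<lceil>y j\<rceil> \<le> of_int \<lceil>x j\<rceil>"
      by (simp_all only: of_int_le_iff)
    moreover have "of_int \<lfloor>y j\<rfloor> \<le> z j \<and> z j \<le> of_int \<lceil>y j\<rceil>" using z by (auto simp: cell_def)
    ultimately show ?thesis by linarith
  qed
  then show "z \<in> cell x" by (simp add: cell_def)
qed

lemma cell_subset_box:
  assumes "x \<in> {z. \<forall>j. 0 \<le> z j \<and> z j \<le> real (M j)}"
  shows "cell x \<subseteq> {z. \<forall>j. 0 \<le> z j \<and> z j \<le> real (M j)}"
proof (intro subsetI CollectI allI)
  fix y j assume y: "y \<in> cell x"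
  have xj: "0 \<le> x j" "x j \<le> real (M j)" using assms by auto
  have "of_int \<lfloor>x j\<rfloor> \<le> y j" "y j \<le> of_int \<lceil>x j\<rceil>" using y by (auto simp: cell_def)
  moreover have "0 \<le> \<lfloor>x j\<rfloor>" "\<lceil>x j\<rceil> \<le> int (M j)" using xj by (auto simp: ceiling_le_iff)
  then have "0 \<le> real_of_int \<lfloor>x j\<rfloor>" "real_of_int \<lceil>x j\<rceil> \<le> real (M j)"
    by linarith+
  ultimately show "0 \<le> y j \<and> y j \<le> real (M j)" by linarith
qed

lemma closed_order_box: "closed {y :: nat \<Rightarrow> real. \<forall>j. l j \<le> y j \<and> y j \<le> u j}"
  by (intro closed_Collect_all closed_Collect_conj closed_Collect_le continuous_on_const
      continuous_on_product_coordinates)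

text \<open>\<open>cell z\<close> is determined by the floors and ceilings of \<open>z\<close>,
  which vanish wherever \<open>M\<close> does. Finiteness lets the cellular induction count
  cells.\<close>

lemma finite_cells:
  assumes "finite {j. M j \<noteq> (0::nat)}"
  shows "finite (cell ` {z. \<forall>j. 0 \<le> z j \<and> z j \<le> real (M j)})"
proof -
  let ?S = "{j. M j \<noteq> 0}"
  let ?B = "\<Union>j\<in>?S. {0..int (M j)}"
  let ?\<F> = "{f. \<forall>j. (j \<in> ?S \<longrightarrow> f j \<in> ?B) \<and> (j \<notin> ?S \<longrightarrow> f j = 0)}"
  have fin: "finite ?\<F>" using assms by (intro finite_set_of_finite_funs) auto
  have "cell ` {z. \<forall>j. 0 \<le> z j \<and> z j \<le> real (M j)} \<subseteq>
      (\<lambda>(l, u). {y. \<forall>j. of_int (l j) \<le> y j \<and> y j \<le> of_int (u j)}) ` (?\<F> \<times> ?\<F>)"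
  proof clarify
    fix z :: "nat \<Rightarrow> real" assume z: "\<forall>j. 0 \<le> z j \<and> z j \<le> real (M j)"
    have b: "0 \<le> \<lfloor>z j\<rfloor>" "\<lfloor>z j\<rfloor> \<le> int (M j)" "0 \<le> \<lceil>z j\<rceil>" "\<lceil>z j\<rceil> \<le> int (M j)" for j
    proof -
      have zj: "0 \<le> z j" "z j \<le> real (M j)" using z by auto
      show "0 \<le> \<lfloor>z j\<rfloor>" "\<lceil>z j\<rceil> \<le> int (M j)" using zj by (auto simp: ceiling_le_iff)
      moreover have "\<lfloor>z j\<rfloor> \<le> \<lceil>z j\<rceil>" by (rule floor_le_ceiling)
      ultimately show "\<lfloor>z j\<rfloor> \<le> int (M j)" "0 \<le> \<lceil>z j\<rceil>" by linarith+
    qed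
    have mem: "f \<in> ?\<F>" if f: "\<And>j. 0 \<le> f j \<and> f j \<le> int (M j)" for f
    proof (intro CollectI allI conjI impI)
      fix j
      show "f j \<in> ?B" if "j \<in> ?S" using that f[of j] by (intro UN_I[of j]) auto
      show "f j = 0" if "j \<notin> ?S" using that f[of j] by simp
    qed
    have "(\<lambda>j. \<lfloor>z j\<rfloor>) \<in> ?\<F>" by (rule mem) (use b in simp)
    moreover have "(\<lambda>j. \<lceil>z j\<rceil>) \<in> ?\<F>" by (rule mem) (use b in simp)
    ultimately show "cell z \<in> (\<lambda>(l, u). {y. \<forall>j. of_int (l j) \<le> y j \<and> y j \<le> of_int (u j)}) ` (?\<F> \<times> ?\<F>)"
      by (intro image_eqI[of _ _ "(\<lambda>j. \<lfloor>z j\<rfloor>, \<lambda>j. \<lceil>z j\<rceil>)"]) (auto simp: cell_def)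
  qed
  then show ?thesis by (rule finite_subset) (use fin in auto)
qed

text \<open>Induction on the number of cells generated by points outside \<open>D\<close>. One of
  least dimension has its boundary in \<open>D\<close>, so \<open>cell_extension\<close> applies;
  its dimension is at most the number of coordinates in which the box is nondegenerate.\<close>

theorem cellular_extension:
  fixes M :: "nat \<Rightarrow> nat"
  defines "Z \<equiv> {z. \<forall>j. 0 \<le> z j \<and> z j \<le> real (M j)}"
  assumes G: "topological_group G T" and M: "finite {j. M j \<noteq> 0}"
    and pi: "\<And>m. m \<le> card {j. M j \<noteq> 0} \<Longrightarrow> trivial_group (group_pi G T m)"
    and F: "continuous_map (top_of_set Z) T F"
    and D: "D \<subseteq> Z" "closed D" "\<And>x. x \<in> D \<Longrightarrow> cell x \<subseteq> D"
    and k: "nullhomotopy (top_of_set D) T \<one>\<^bsub>G\<^esub> F k"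
  shows "\<exists>k'. nullhomotopy (top_of_set Z) T \<one>\<^bsub>G\<^esub> F k' \<and> (\<forall>x\<in>D. \<forall>t\<in>{0..1}. k' (x, t) = k (x, t))"
  using D k
proof (induction "card (cell ` (Z - D))" arbitrary: D k rule: less_induct)
  case less
  show ?case
  proof (cases "D = Z")
    case True
    then show ?thesis using less.prems by blast
  next
    case False
    define J where "J x = {j. x j \<notin> \<int>}" for x :: "nat \<Rightarrow> real"
    \<comment> \<open>by minimality, the boundary of the cell of \<open>x\<close> lies in \<open>D\<close>\<close>
    have "\<exists>x. x \<in> Z - D" using False less.prems(1) by auto
    then obtain x where x: "x \<in> Z - D" and xmin: "\<And>y. y \<in> Z - D \<Longrightarrow> card (J x) \<le> card (J y)"
      using ex_has_least_nat[of "\<lambda>x. x \<in> Z - D" _ "\<lambda>x. card (J x)"] by metis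
    have J_sub: "J y \<subseteq> {j. M j \<noteq> 0}" if "y \<in> Z" for y
    proof
      fix j assume j: "j \<in> J y"
      have "M j = 0 \<Longrightarrow> y j = 0" using that unfolding Z_def by (auto dest: spec[of _ j])
      then show "j \<in> {j. M j \<noteq> 0}" using j by (cases "M j = 0") (auto simp: J_def)
    qed
    have J_fin: "finite (J y)" if "y \<in> Z" for y
      using J_sub[OF that] M finite_subset by blast
    have xZ: "x \<in> Z" and xD: "x \<notin> D" using x by auto
    \<comment> \<open>The closed cell of \<open>x\<close> in the form that
      \<open>cell_extension\<close> expects, with the corner \<open>lo\<close> given by the
      floors.\<close>
    define e :: "(nat \<Rightarrow> real) set" where "e = {y. \<forall>j. of_int \<lfloor>x j\<rfloor> \<le> y j \<and> y j \<le> of_int \<lfloor>x j\<rfloor> + of_bool (j \<in> J x)}"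
    define b where "b = {y \<in> e. \<exists>j\<in>J x. y j = of_int \<lfloor>x j\<rfloor> \<or> y j = of_int \<lfloor>x j\<rfloor> + 1}"
    have ceil: "of_int \<lceil>x j\<rceil> = of_int \<lfloor>x j\<rfloor> + (of_bool (j \<in> J x) :: real)" for j
    proof -
      have "x j \<in> \<int> \<longleftrightarrow> x j = of_int \<lfloor>x j\<rfloor>" by (metis Ints_of_int Ints_cases floor_of_int)
      then show ?thesis by (simp add: J_def ceiling_altdef)
    qed
    have e_cell: "e = cell x" unfolding e_def cell_def ceil ..
    have e_J: "y j = x j" if "y \<in> e" "j \<notin> J x" for y j
    proof -
      have "x j \<in> \<int>" using that by (simp add: J_def)
      moreover have "of_int \<lfloor>x j\<rfloor> \<le> y j" "y j \<le> of_int \<lfloor>x j\<rfloor>"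
        using that unfolding e_def by (auto dest: spec[of _ j])
      ultimately show ?thesis by (auto elim!: Ints_cases)
    qed
    have e_Z: "e \<subseteq> Z"
      using cell_subset_box[of x M] xZ unfolding e_cell Z_def by blast
    have b_D: "b \<subseteq> D"
    proof
      fix y assume y: "y \<in> b"
      then obtain j where j: "j \<in> J x" "y j = of_int \<lfloor>x j\<rfloor> \<or> y j = of_int \<lfloor>x j\<rfloor> + 1"
        by (auto simp: b_def)
      have "y \<in> e" using y by (simp add: b_def)
      have "j \<notin> J y" using j(2) by (auto simp: J_def)
      moreover have "J y \<subseteq> J x" using e_J[OF \<open>y \<in> e\<close>] by (auto simp: J_def)
      ultimately have "J y \<subset> J x" using j(1) by blast
      then have "card (J y) < card (J x)" using J_fin[OF xZ] by (simp add: psubset_card_mono)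
      then show "y \<in> D" using xmin[of y] e_Z \<open>y \<in> e\<close> by force
    qed
    \<comment> \<open>A point of \<open>D\<close> in the open cell would have \<open>x\<close> in
      its own cell, and saturation of \<open>D\<close> would put \<open>x\<close> into
      \<open>D\<close>. So the new cell meets \<open>D\<close> in its boundary only, where the two
      nullhomotopies agree.\<close>
    have e_D: "y \<in> b" if "y \<in> e" "y \<in> D" for y
    proof (rule ccontr)
      assume nb: "y \<notin> b"
      have "x \<in> cell y"
        unfolding cell_def
      proof (intro CollectI allI)
        fix j
        show "of_int \<lfloor>y j\<rfloor> \<le> x j \<and> x j \<le> of_int \<lceil>y j\<rceil>"
        proof (cases "j \<in> J x")
          case False
          then show ?thesis using e_J[OF that(1), of j] by simp
        next
          case True
          then have "of_int \<lfloor>x j\<rfloor> < y j" "y j < of_int \<lfloor>x j\<rfloor> + 1"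
            using that(1) nb by (force simp: b_def e_def dest: spec[of _ j])+
          then have "\<lfloor>y j\<rfloor> = \<lfloor>x j\<rfloor>" "\<lceil>y j\<rceil> = \<lfloor>x j\<rfloor> + 1"
            by linarith+
          then show ?thesis by simp
        qed
      qed
      then show False using less.prems(3)[OF that(2)] xD by blast
    qed
    have Fe: "continuous_map (top_of_set e) T F"
      using continuous_map_from_subtopology_mono[OF F e_Z] .
    have kb: "nullhomotopy (top_of_set b) T \<one>\<^bsub>G\<^esub> F k"
      using nullhomotopy_top_of_set_subset[OF less.prems(4) b_D] .
    have "trivial_group (group_pi G T (card (J x)))"
      by (intro pi card_mono M J_sub xZ)
    from cell_extension[OF G J_fin[OF xZ] this Fe[unfolded e_def] kb[unfolded b_def e_def], folded e_def, folded b_def]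
    obtain k1 where k1: "nullhomotopy (top_of_set e) T \<one>\<^bsub>G\<^esub> F k1"
      and k1b: "\<And>y t. y \<in> b \<Longrightarrow> t \<in> {0..1} \<Longrightarrow> k1 (y, t) = k (y, t)"
      by metis
    define I where "I = {0..1::real}"
    define k2 where "k2 z = (if z \<in> D \<times> I then k z else k1 z)" for z
    have closed_e: "closed e" unfolding e_def by (rule closed_order_box)
    have "closed I" by (simp add: I_def)
    have k2c: "continuous_map (top_of_set ((D \<union> e) \<times> I)) T k2"
      unfolding k2_def
    proof (rule continuous_map_paste_closed)
      show "closedin (top_of_set ((D \<union> e) \<times> I)) (D \<times> I)"
        "closedin (top_of_set ((D \<union> e) \<times> I)) (e \<times> I)"
        using closed_e \<open>closed D\<close> \<open>closed I\<close> by (auto intro!: closed_subset closed_Times)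
      show "topspace (top_of_set ((D \<union> e) \<times> I)) \<subseteq> D \<times> I \<union> e \<times> I"
        by auto
      have eq: "(D \<union> e) \<times> I \<inter> D \<times> I = D \<times> I" "(D \<union> e) \<times> I \<inter> e \<times> I = e \<times> I"
        by auto
      show "continuous_map (subtopology (top_of_set ((D \<union> e) \<times> I)) (D \<times> I)) T k"
        "continuous_map (subtopology (top_of_set ((D \<union> e) \<times> I)) (e \<times> I)) T k1"
        using less.prems(4) k1
        by (simp_all only: nullhomotopy_def subtopology_subtopology eq prod_topology_subtopology_eu I_def[symmetric])
      show "k z = k1 z" if "z \<in> D \<times> I" "z \<in> e \<times> I" for z
        using that k1b e_D by (cases z) (auto simp: I_def)
    qed
    have "nullhomotopy (top_of_set (D \<union> e)) T \<one>\<^bsub>G\<^esub> F k2"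
      unfolding nullhomotopy_def
    proof (intro conjI ballI)
      show "continuous_map (prod_topology (top_of_set (D \<union> e)) (top_of_set {0..1})) T k2"
        using k2c by (simp add: prod_topology_subtopology_eu I_def)
    next
      fix y assume "y \<in> topspace (top_of_set (D \<union> e))"
      then have y: "y \<in> D \<or> y \<in> e" by simp
      show "k2 (y, 0) = \<one>\<^bsub>G\<^esub>" "k2 (y, 1) = F y"
        using less.prems(4) k1 y by (auto simp: k2_def nullhomotopy_def I_def)
    qed
    moreover have "card (cell ` (Z - (D \<union> e))) < card (cell ` (Z - D))"
    proof (rule psubset_card_mono)
      have "cell ` (Z - D) \<subseteq> cell ` Z" by (rule image_mono) simp
      then show "finite (cell ` (Z - D))"
        using finite_cells[OF M] unfolding Z_def[symmetric] by (rule finite_subset)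
      \<comment> \<open>Every \<open>y\<close> outside \<open>e\<close> lies in its own cell, which
        therefore differs from \<open>e\<close>; so one cell disappears from the count.\<close>
      have "cell x \<notin> cell ` (Z - (D \<union> e))"
      proof
        assume "cell x \<in> cell ` (Z - (D \<union> e))"
        then obtain y where "y \<notin> e" "cell x = cell y" by blast
        then show False using self_mem_cell[of y] e_cell by simp
      qed
      moreover have "cell x \<in> cell ` (Z - D)" using x by (rule imageI)
      moreover have "cell ` (Z - (D \<union> e)) \<subseteq> cell ` (Z - D)" by (rule image_mono) blast
      ultimately show "cell ` (Z - (D \<union> e)) \<subset> cell ` (Z - D)" by (simp only: psubset_eq) metis
    qed
    moreover have "D \<union> e \<subseteq> Z" using less.prems(1) e_Z by simp
    moreover have "closed (D \<union> e)" using less.prems(2) closed_e by (rule closed_Un)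
    moreover have "cell y \<subseteq> D \<union> e" if "y \<in> D \<union> e" for y
      using that less.prems(3)[of y] cell_mono[of y x] e_cell by auto
    ultimately have "\<exists>k'. nullhomotopy (top_of_set Z) T \<one>\<^bsub>G\<^esub> F k' \<and>
        (\<forall>y\<in>D \<union> e. \<forall>t\<in>{0..1}. k' (y, t) = k2 (y, t))"
      by (intro less.hyps)
    then obtain k' where k': "nullhomotopy (top_of_set Z) T \<one>\<^bsub>G\<^esub> F k'"
      "\<And>y t. y \<in> D \<union> e \<Longrightarrow> t \<in> {0..1} \<Longrightarrow> k' (y, t) = k2 (y, t)"
      by metis
    have "k' (y, t) = k (y, t)" if "y \<in> D" "t \<in> {0..1}" for y t
      using k'(2)[of y t] that by (simp add: k2_def I_def)
    then show ?thesis using k'(1) by metis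
  qed
qed

section \<open>Extension over charts\<close>

text \<open>The \<open>n\<close>-cube in the convention of \<open>Euclidean_space\<close>, with
  coordinates from \<open>n\<close> on equal to 0; as a product of compact intervals it is compact
  in the infinite product.\<close>

definition unit_box :: "nat \<Rightarrow> (nat \<Rightarrow> real) set" where
  "unit_box n = {z. \<forall>j. 0 \<le> z j \<and> z j \<le> of_bool (j < n)}"

definition open_unit_box :: "nat \<Rightarrow> (nat \<Rightarrow> real) set" where
  "open_unit_box n = {z \<in> unit_box n. \<forall>j<n. 0 < z j \<and> z j < 1}"

lemma compact_unit_box: "compact (unit_box n)"
proof -
  have "unit_box n = (\<Pi>\<^sub>E j\<in>UNIV. {0..of_bool (j < n)})"
    by (simp add: unit_box_def set_eq_iff PiE_iff)
  then have "compactin (product_topology (\<lambda>_. euclideanreal) UNIV) (unit_box n)"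
    by (simp add: compactin_PiE)
  then show ?thesis by (simp add: euclidean_product_topology)
qed

lemma closed_unit_box: "closed (unit_box n)"
  unfolding unit_box_def by (rule closed_order_box)

text \<open>The chart is a closed cube because compactness makes \<open>\<phi>\<close> an embedding
  with closed images once \<open>X\<close> is Hausdorff; only openness of the image of the interior
  has to be demanded.\<close>

definition chart_box :: "nat \<Rightarrow> 'x topology \<Rightarrow> ((nat \<Rightarrow> real) \<Rightarrow> 'x) \<Rightarrow> bool" where
  "chart_box n X \<phi> \<longleftrightarrow> continuous_map (top_of_set (unit_box n)) X \<phi> \<and> inj_on \<phi> (unit_box n) \<and>
     openin X (\<phi> ` open_unit_box n)"

lemma chart_box_closedin:
  assumes "Hausdorff_space X" "chart_box n X \<phi>" "K \<subseteq> unit_box n" "closed K"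
  shows "closedin X (\<phi> ` K)" "compactin X (\<phi> ` K)"
proof -
  have "compact K" using assms compact_unit_box by (metis compact_Int_closed inf.absorb_iff2)
  then have "compactin (top_of_set (unit_box n)) K"
    using assms(3) by (simp add: compactin_subtopology)
  then show "compactin X (\<phi> ` K)"
    using assms(2) image_compactin unfolding chart_box_def by blast
  then show "closedin X (\<phi> ` K)"
    using assms(1) compactin_imp_closedin by blast
qed

text \<open>A continuous injection from a compact space to a Hausdorff space is a closed map, hence
  an embedding.\<close>

lemma chart_box_inverse:
  assumes "Hausdorff_space X" "chart_box n X \<phi>"
  obtains \<psi> where "continuous_map (subtopology X (\<phi> ` unit_box n)) (top_of_set (unit_box n)) \<psi>"
    "\<And>z. z \<in> unit_box n \<Longrightarrow> \<psi> (\<phi> z) = z"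
proof -
  have c: "continuous_map (top_of_set (unit_box n)) X \<phi>" and i: "inj_on \<phi> (unit_box n)"
    using assms(2) by (auto simp: chart_box_def)
  have "closed_map (top_of_set (unit_box n)) X \<phi>"
    by (rule continuous_imp_closed_map_gen[OF _ Hausdorff_imp_kc_space[OF assms(1)] c])
      (simp add: compact_space_subtopology compact_unit_box)
  then have "embedding_map (top_of_set (unit_box n)) X \<phi>"
    using c i by (simp add: injective_closed_imp_embedding_map)
  then obtain \<psi> where "homeomorphic_maps (top_of_set (unit_box n)) (subtopology X (\<phi> ` unit_box n)) \<phi> \<psi>"
    unfolding embedding_map_def homeomorphic_map_maps by auto
  then show ?thesis using that[of \<psi>] unfolding homeomorphic_maps_def by auto
qed

text \<open>\<open>N\<close> is the part of \<open>X\<close> already treated. The boundary clause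
  makes the final contraction one of based cube maps, and makes \<open>k\<close> compatible with the
  constant 1 prescribed on the side faces during the cellular extension.\<close>

definition partial_nullhomotopy ::
    "nat \<Rightarrow> 'x topology \<Rightarrow> 'g topology \<Rightarrow> 'g \<Rightarrow> ((nat \<Rightarrow> real) \<times> 'x \<Rightarrow> 'g) \<Rightarrow> 'x set \<Rightarrow>
      (((nat \<Rightarrow> real) \<times> 'x) \<times> real \<Rightarrow> 'g) \<Rightarrow> bool" where
  "partial_nullhomotopy i X T e F N k \<longleftrightarrow>
     nullhomotopy (prod_topology (cube i) (subtopology X N)) T e F k \<and>
     (\<forall>y\<in>cube_boundary i. \<forall>x\<in>topspace X \<inter> N. \<forall>t\<in>{0..1}. k ((y, x), t) = e)"

text \<open>Restricting to \<open>N\<close> becomes a condition on one coordinate of a fixed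
  product, so that restriction and pasting are statements about subtopologies.\<close>

lemma slab_eq:
  "prod_topology (prod_topology Y (subtopology X N)) I =
   subtopology (prod_topology (prod_topology Y X) I) {p. snd (fst p) \<in> N}"
proof -
  have "prod_topology (prod_topology Y (subtopology X N)) I =
      subtopology (prod_topology (prod_topology Y X) I) ((topspace Y \<times> N) \<times> topspace I)"
    by (simp add: prod_topology_subtopology)
  also have "\<dots> = subtopology (prod_topology (prod_topology Y X) I)
      (topspace (prod_topology (prod_topology Y X) I) \<inter> ((topspace Y \<times> N) \<times> topspace I))"
    by (simp only: subtopology_restrict)
  also have "topspace (prod_topology (prod_topology Y X) I) \<inter> ((topspace Y \<times> N) \<times> topspace I) =
      topspace (prod_topology (prod_topology Y X) I) \<inter> {p. snd (fst p) \<in> N}"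
    by auto
  finally show ?thesis by (simp only: subtopology_restrict)
qed

text \<open>The maximum distance has a positive minimum on the compact product of \<open>C\<close>
  and \<open>R\<close>. Scaling by a number exceeding its reciprocal prevents a grid cube of side 1
  from meeting both sets.\<close>

lemma grid_scale:
  assumes "compact C" "compact R" "C \<inter> R = {}" "C \<subseteq> unit_box n" "R \<subseteq> unit_box n"
  obtains M :: nat where "0 < M"
    "\<And>c w. c \<in> C \<Longrightarrow> w \<in> R \<Longrightarrow> \<exists>j<n. 1 < \<bar>real M * c j - real M * w j\<bar>"
proof (cases "C = {} \<or> R = {}")
  case True
  then show ?thesis using that[of 1] by auto
next
  case False
  define g where "g p = max_norm {..<n} (\<lambda>j. fst p j - snd p j)" for p :: "(nat \<Rightarrow> real) \<times> (nat \<Rightarrow> real)"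
  have "continuous_on (C \<times> R) g"
    unfolding g_def
    by (intro continuous_intros finite_lessThan
        continuous_on_product_then_coordinatewise[of _ fst] continuous_on_product_then_coordinatewise[of _ snd])
  moreover have "compact (C \<times> R)" using assms by (intro compact_Times)
  ultimately obtain p where p: "p \<in> C \<times> R" and pmin: "\<And>q. q \<in> C \<times> R \<Longrightarrow> g p \<le> g q"
    using continuous_attains_inf[of "C \<times> R" g] False by blast
  have "0 < g p"
  proof (rule ccontr)
    assume "\<not> 0 < g p"
    then have "g p \<le> 0" by simp
    then have *: "fst p j = snd p j" if "j < n" for j
      using that max_norm_ge[of "{..<n}" j "\<lambda>j. fst p j - snd p j"] unfolding g_def by simp
    \<comment> \<open>The norm sees only coordinates below \<open>n\<close>; the others are 0 in the
      box.\<close>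
    have "fst p \<in> unit_box n" "snd p \<in> unit_box n" using p assms by auto
    then have "fst p j = snd p j" for j
      using *[of j] unfolding unit_box_def by (cases "j < n") (auto dest!: spec[of _ j])
    then have "fst p = snd p" by blast
    then show False using p assms(3) by (cases p) auto
  qed
  then obtain m where m: "inverse (real (Suc m)) < g p" using reals_Archimedean by blast
  show ?thesis
  proof (rule that[of "Suc m"])
    fix c w assume "c \<in> C" "w \<in> R"
    then have "inverse (real (Suc m)) < g (c, w)" using pmin[of "(c, w)"] m by auto
    moreover have pos: "0 < inverse (real (Suc m))" by simp
    ultimately have "\<not> (\<forall>j\<in>{..<n}. \<bar>c j - w j\<bar> \<le> inverse (real (Suc m)))"
      unfolding g_def using max_norm_le_iff[of "{..<n}" "inverse (real (Suc m))" "\<lambda>j. c j - w j"] by auto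
    then obtain j where j: "j < n" "inverse (real (Suc m)) < \<bar>c j - w j\<bar>" by force
    have "1 < real (Suc m) * \<bar>c j - w j\<bar>"
      using mult_strict_left_mono[OF j(2), of "real (Suc m)"] by (simp add: field_simps)
    also have "\<dots> = \<bar>real (Suc m) * c j - real (Suc m) * w j\<bar>"
      by (simp only: right_diff_distrib[symmetric] abs_mult abs_of_nat)
    finally show "\<exists>j<n. 1 < \<bar>real (Suc m) * c j - real (Suc m) * w j\<bar>" using j(1) by blast
  qed simp
qed

text \<open>The grid cubes that miss \<open>C\<close> form \<open>R\<close>. The old
  \<open>k\<close> is discarded over \<open>R\<close> and retained over \<open>N\<close> minus the
  image of \<open>R\<close>, which is open and contains \<open>C\<close>. Where this set overlaps
  the open chart, only points of \<open>A\<close> occur, and there the new nullhomotopy continues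
  \<open>k\<close>; so the two paste along an open cover.\<close>

theorem chart_box_extension:
  assumes G: "topological_group G T" and X: "Hausdorff_space X" and \<phi>: "chart_box n X \<phi>"
    and pi: "\<And>m. m \<le> i + n \<Longrightarrow> trivial_group (group_pi G T m)"
    and F: "continuous_map (prod_topology (cube i) X) T F"
    and Fb: "\<And>y x. y \<in> cube_boundary i \<Longrightarrow> x \<in> topspace X \<Longrightarrow> F (y, x) = \<one>\<^bsub>G\<^esub>"
    and N: "openin X N" and C: "closedin X C" "C \<subseteq> N"
    and k: "partial_nullhomotopy i X T \<one>\<^bsub>G\<^esub> F N k"
  obtains N' k' where "openin X N'" "C \<union> \<phi> ` open_unit_box n \<subseteq> N'"
    "partial_nullhomotopy i X T \<one>\<^bsub>G\<^esub> F N' k'"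
    "\<And>y x t. x \<in> C \<Longrightarrow> k' ((y, x), t) = k ((y, x), t)"
proof -
  have topT: "topspace T = carrier G" and one: "\<one>\<^bsub>G\<^esub> \<in> carrier G"
    using G by (auto simp: topological_group_def group.is_monoid monoid.one_closed)
  define I where "I = {0..1::real}"
  have I01: "0 \<in> I" "1 \<in> I" by (auto simp: I_def)
  have closed_I: "closed I" by (simp add: I_def)
  have cont_coord: "continuous_on S (\<lambda>y. y j)" for S :: "(nat \<Rightarrow> real) set" and j
    by (rule continuous_on_product_then_coordinatewise) (rule continuous_on_id)
  obtain \<psi> where \<psi>c: "continuous_map (subtopology X (\<phi> ` unit_box n)) (top_of_set (unit_box n)) \<psi>"
    and \<psi>: "\<And>z. z \<in> unit_box n \<Longrightarrow> \<psi> (\<phi> z) = z"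
    using chart_box_inverse[OF X \<phi>] by blast
  have \<phi>c: "continuous_map (top_of_set (unit_box n)) X \<phi>"
    and \<phi>o: "openin X (\<phi> ` open_unit_box n)"
    using \<phi> by (auto simp: chart_box_def)
  have \<phi>X: "\<phi> z \<in> topspace X" if "z \<in> unit_box n" for z
    using continuous_map_image_subset_topspace[OF \<phi>c] that by auto
  have k': "continuous_map (prod_topology (prod_topology (cube i) (subtopology X N)) (top_of_set I)) T k"
    and k0: "\<And>y x. y \<in> topspace (cube i) \<Longrightarrow> x \<in> topspace X \<Longrightarrow> x \<in> N \<Longrightarrow> k ((y, x), 0) = \<one>\<^bsub>G\<^esub>"
    and k1: "\<And>y x. y \<in> topspace (cube i) \<Longrightarrow> x \<in> topspace X \<Longrightarrow> x \<in> N \<Longrightarrow> k ((y, x), 1) = F (y, x)"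
    and kb: "\<And>y x t. y \<in> cube_boundary i \<Longrightarrow> x \<in> topspace X \<Longrightarrow> x \<in> N \<Longrightarrow> t \<in> I \<Longrightarrow> k ((y, x), t) = \<one>\<^bsub>G\<^esub>"
    using k unfolding partial_nullhomotopy_def nullhomotopy_def I_def by auto

  \<comment> \<open>grid cubes \<open>Q a\<close> of side \<open>1 / M\<close>: those meeting \<open>C\<close> form \<open>A\<close> and lie over \<open>N\<close>, the others form \<open>R\<close>\<close>
  define C' where "C' = {z \<in> unit_box n. \<phi> z \<in> C}"
  define R0 where "R0 = {z \<in> unit_box n. \<phi> z \<in> topspace X - N}"
  have "closedin (top_of_set (unit_box n)) C'" "closedin (top_of_set (unit_box n)) R0"
    using closedin_continuous_map_preimage[OF \<phi>c, of C]
      closedin_continuous_map_preimage[OF \<phi>c, of "topspace X - N"] C N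
    by (auto simp: C'_def R0_def)
  then have "compact C'" "compact R0"
    using closedin_compact[OF compact_unit_box] by auto
  moreover have "C' \<inter> R0 = {}" using C(2) by (auto simp: C'_def R0_def)
  ultimately obtain M :: nat where M: "0 < M"
    and sep: "\<And>c w. c \<in> C' \<Longrightarrow> w \<in> R0 \<Longrightarrow> \<exists>j<n. 1 < \<bar>real M * c j - real M * w j\<bar>"
    by (rule grid_scale[of _ _ n]) (auto simp: C'_def R0_def)

  \<comment> \<open>Indices run up to \<open>M\<close> itself because the floor of
    \<open>real M * w j\<close> equals \<open>M\<close> at \<open>w j = 1\<close>; the extra layer
    consists of faces only. Coordinates from \<open>n\<close> on have index 0.\<close>
  define \<A> where "\<A> = {a :: nat \<Rightarrow> int. \<forall>j. (j \<in> {..<n} \<longrightarrow> a j \<in> {0..int M}) \<and> (j \<notin> {..<n} \<longrightarrow> a j = 0)}"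
  define Q where "Q a = {w \<in> unit_box n. \<forall>j. of_int (a j) \<le> real M * w j \<and> real M * w j \<le> of_int (a j) + 1}"
    for a :: "nat \<Rightarrow> int"
  define A where "A = (\<Union>a\<in>{a \<in> \<A>. Q a \<inter> C' \<noteq> {}}. Q a)"
  define R where "R = (\<Union>a\<in>{a \<in> \<A>. Q a \<inter> C' = {}}. Q a)"
  have fin: "finite \<A>" unfolding \<A>_def by (intro finite_set_of_finite_funs) auto
  have closed_Q: "closed (Q a)" for a
  proof -
    have "Q a = unit_box n \<inter> {w. \<forall>j. of_int (a j) \<le> real M * w j \<and> real M * w j \<le> of_int (a j) + 1}"
      by (auto simp: Q_def)
    then show ?thesis
      by (auto intro!: closed_Int closed_unit_box closed_Collect_all closed_Collect_conj
          closed_Collect_le continuous_on_mult continuous_on_const cont_coord)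
  qed
  have closed_AR: "closed A" "closed R"
    unfolding A_def R_def using fin closed_Q by (auto intro!: closed_UN)
  have AR_sub: "A \<subseteq> unit_box n" "R \<subseteq> unit_box n" by (auto simp: A_def R_def Q_def)
  have AR: "w \<in> A \<or> w \<in> R" if w: "w \<in> unit_box n" for w
  proof -
    define a where "a j = \<lfloor>real M * w j\<rfloor>" for j
    have wj: "0 \<le> w j" "w j \<le> of_bool (j < n)" for j using w by (auto simp: unit_box_def)
    have "a \<in> \<A>"
      unfolding \<A>_def
    proof (intro CollectI allI conjI impI)
      fix j
      have "real M * w j \<le> real M * 1" if "j < n"
        using wj[of j] that by (intro mult_left_mono) auto
      then have "\<lfloor>real M * w j\<rfloor> \<le> int M" if "j < n"
        using that floor_mono[of "real M * w j" "real M"] by simp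
      then show "a j \<in> {0..int M}" if "j \<in> {..<n}"
        using wj[of j] that by (auto simp: a_def)
      show "a j = 0" if "j \<notin> {..<n}"
        using wj[of j] that by (simp add: a_def)
    qed
    moreover have "w \<in> Q a"
      unfolding Q_def a_def using w by (auto intro: less_imp_le real_of_int_floor_add_one_gt)
    ultimately show ?thesis by (auto simp: A_def R_def)
  qed
  have R_C: "w \<notin> C'" if "w \<in> R" for w
    using that by (auto simp: R_def)
  \<comment> \<open>A grid cube meeting \<open>C'\<close> contains no point over the complement of
    \<open>N\<close>: two of its points differ by at most 1 in each scaled coordinate, against
    \<open>sep\<close>.\<close>
  have A_N: "\<phi> w \<in> N" if wA: "w \<in> A" for w
  proof (rule ccontr)
    assume nN: "\<phi> w \<notin> N"
    obtain a c where a: "w \<in> Q a" "c \<in> Q a" "c \<in> C'" using wA by (auto simp: A_def)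
    have "w \<in> R0" using a nN \<phi>X by (auto simp: R0_def Q_def)
    then obtain j where "1 < \<bar>real M * c j - real M * w j\<bar>" using sep[OF a(3)] by blast
    moreover have "of_int (a j) \<le> real M * w j" "real M * w j \<le> of_int (a j) + 1"
      "of_int (a j) \<le> real M * c j" "real M * c j \<le> of_int (a j) + 1"
      using a by (auto simp: Q_def)
    ultimately show False by linarith
  qed

  \<comment> \<open>\<open>Z\<close> is the cube times the chart, rescaled so that the grid becomes integral\<close>
  define M' where "M' j = (if j < i then 1 else if j < i + n then M else 0)" for j
  define Z where "Z = {z. \<forall>j. 0 \<le> z j \<and> z j \<le> real (M' j)}"
  \<comment> \<open>Since \<open>M > 0\<close>, exactly \<open>i + n\<close> coordinates are
    nondegenerate; this is the bound in \<open>pi\<close>.\<close>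
  have M': "{j. M' j \<noteq> 0} = {..<i + n}" using M by (auto simp: M'_def)
  define yc where "yc z = restrict z {..<i}" for z :: "nat \<Rightarrow> real"
  define xc where "xc z = (\<lambda>j. z (i + j) / real M)" for z :: "nat \<Rightarrow> real"
  have yc_cube: "yc z \<in> topspace (cube i)" if "z \<in> Z" for z
  proof -
    have "0 \<le> z j \<and> z j \<le> 1" if "j < i" for j
      using \<open>z \<in> Z\<close> that unfolding Z_def M'_def by (auto dest: spec[of _ j])
    then show ?thesis by (auto simp: topspace_cube yc_def)
  qed
  have xc_box: "xc z \<in> unit_box n" if z: "z \<in> Z" for z
    unfolding unit_box_def
  proof (intro CollectI allI)
    fix j
    have "0 \<le> z (i + j)" "z (i + j) \<le> real (M' (i + j))" using z by (auto simp: Z_def)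
    moreover have "real (M' (i + j)) = real M * of_bool (j < n)" by (simp add: M'_def)
    ultimately show "0 \<le> xc z j \<and> xc z j \<le> of_bool (j < n)"
      using M by (simp add: xc_def field_simps)
  qed
  have closed_Z: "closed Z" unfolding Z_def by (rule closed_order_box)
  have ycc: "continuous_map (top_of_set Z) (cube i) yc"
    unfolding cube_def continuous_map_componentwise
  proof (intro conjI ballI)
    show "yc ` topspace (top_of_set Z) \<subseteq> extensional {..<i}" by (auto simp: yc_def)
    fix j assume j: "j \<in> {..<i}"
    then have "continuous_on Z (\<lambda>z. yc z j)" by (simp add: yc_def cont_coord)
    moreover have "yc z j \<in> {0..1}" if "z \<in> Z" for z
      using yc_cube[OF that] j by (auto simp: topspace_cube PiE_iff)
    ultimately show "continuous_map (top_of_set Z) (top_of_set {0..1}) (\<lambda>z. yc z j)"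
      by (auto simp: continuous_map_subtopology_eu)
  qed
  have xc_cont: "continuous_on S xc" for S
    unfolding xc_def using M
    by (intro continuous_on_coordinatewise_then_product continuous_on_divide continuous_on_const cont_coord) auto
  have xcc: "continuous_map (top_of_set Z) (top_of_set (unit_box n)) xc"
    using xc_cont xc_box by (auto simp: continuous_map_subtopology_eu)
  have \<phi>xc: "continuous_map (top_of_set Z) X (\<lambda>z. \<phi> (xc z))"
    using continuous_map_compose[OF xcc \<phi>c] by (simp add: o_def)
  define F' where "F' z = F (yc z, \<phi> (xc z))" for z
  have F'c: "continuous_map (top_of_set Z) T F'"
    using continuous_map_compose[OF continuous_map_pairedI[OF ycc \<phi>xc] F] by (simp add: o_def F'_def[abs_def])

  \<comment> \<open>The nullhomotopy is prescribed over \<open>D1\<close> by \<open>k\<close> and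
    over the side faces \<open>D2\<close> by the constant 1; the latter preserves the boundary
    condition.\<close>
  define D1 where "D1 = {z \<in> Z. xc z \<in> A}"
  define D2 where "D2 = {z \<in> Z. \<exists>j<i. z j = 0 \<or> z j = 1}"
  have D2_bd: "yc z \<in> cube_boundary i" if "z \<in> D2" for z
    using that yc_cube[of z] by (auto simp: D2_def cube_boundary_def yc_def)
  have "closed (Z \<inter> xc -` A)"
    by (intro closed_Int closed_Z closed_vimage closed_AR) (rule xc_cont)
  then have closed_D1: "closed D1" by (simp add: D1_def vimage_def Int_def)
  have "closed (\<Union>j\<in>{..<i}. {z. z j = (0::real)} \<union> {z. z j = 1})"
    by (intro closed_UN closed_Un closed_Collect_eq finite_lessThan ballI cont_coord continuous_on_const)
  moreover have "D2 = Z \<inter> (\<Union>j\<in>{..<i}. {z. z j = (0::real)} \<union> {z. z j = 1})"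
    by (auto simp: D2_def)
  ultimately have closed_D2: "closed D2" using closed_Z by auto
  \<comment> \<open>A coordinate equal to 0 or 1 stays fixed on the cell, which settles
    \<open>D2\<close>. For \<open>D1\<close>, the bounds defining \<open>Q a\<close> become integers
    after scaling and so hold on the entire cell.\<close>
  have sat: "cell z \<subseteq> D1 \<union> D2" if z: "z \<in> D1 \<union> D2" for z
  proof
    fix y assume y: "y \<in> cell z"
    have "z \<in> Z" using z by (auto simp: D1_def D2_def)
    then have yZ: "y \<in> Z" using cell_subset_box y unfolding Z_def by blast
    have yj: "of_int \<lfloor>z j\<rfloor> \<le> y j" "y j \<le> of_int \<lceil>z j\<rceil>" for j using y by (auto simp: cell_def)
    show "y \<in> D1 \<union> D2"
    proof (cases "z \<in> D2")
      case True
      then obtain j where j: "j < i" "z j = 0 \<or> z j = 1" by (auto simp: D2_def)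
      then have "y j = 0 \<or> y j = 1" using yj[of j] by auto
      then show ?thesis using j yZ by (auto simp: D2_def)
    next
      case False
      then obtain a where a: "a \<in> \<A>" "Q a \<inter> C' \<noteq> {}" "xc z \<in> Q a"
        using z by (auto simp: D1_def A_def)
      have "of_int (a j) \<le> real M * xc y j \<and> real M * xc y j \<le> of_int (a j) + 1" for j
      proof -
        have "of_int (a j) \<le> z (i + j)" "z (i + j) \<le> of_int (a j + 1)"
          using a(3) M by (auto simp: Q_def xc_def)
        then have "a j \<le> \<lfloor>z (i + j)\<rfloor>" "\<lceil>z (i + j)\<rceil> \<le> a j + 1"
          by (simp_all only: le_floor_iff ceiling_le_iff)
        then have "real_of_int (a j) \<le> of_int \<lfloor>z (i + j)\<rfloor>" "real_of_int \<lceil>z (i + j)\<rceil> \<le> of_int (a j + 1)"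
          by (simp_all only: of_int_le_iff)
        then show ?thesis using yj[of "i + j"] M by (simp add: xc_def)
      qed
      then have "xc y \<in> Q a" using xc_box[OF yZ] by (simp add: Q_def)
      then show ?thesis using a yZ by (auto simp: D1_def A_def)
    qed
  qed

  define k2 where "k2 p = (if p \<in> D1 \<times> I then k ((yc (fst p), \<phi> (xc (fst p))), snd p) else \<one>\<^bsub>G\<^esub>)" for p
  have "continuous_map (top_of_set ((D1 \<union> D2) \<times> I)) T k2"
    unfolding k2_def
  proof (rule continuous_map_paste_closed)
    show "closedin (top_of_set ((D1 \<union> D2) \<times> I)) (D1 \<times> I)"
      "closedin (top_of_set ((D1 \<union> D2) \<times> I)) (D2 \<times> I)"
      using closed_D1 closed_D2 closed_I by (auto intro!: closed_subset closed_Times)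
    show "topspace (top_of_set ((D1 \<union> D2) \<times> I)) \<subseteq> D1 \<times> I \<union> D2 \<times> I"
      by auto
    have D1Z: "D1 \<subseteq> Z" by (auto simp: D1_def)
    have c1: "continuous_map (top_of_set (D1 \<times> I)) (top_of_set D1) fst"
      "continuous_map (top_of_set (D1 \<times> I)) (top_of_set I) snd"
      using continuous_map_fst[of "top_of_set D1" "top_of_set I"]
        continuous_map_snd[of "top_of_set D1" "top_of_set I"]
      by (simp_all only: prod_topology_subtopology_eu)
    have "continuous_map (top_of_set D1) (subtopology X N) (\<lambda>z. \<phi> (xc z))"
      using continuous_map_from_subtopology_mono[OF \<phi>xc D1Z] A_N
      by (auto simp: continuous_map_in_subtopology D1_def)
    from continuous_map_compose[OF c1(1) this]
    have c2: "continuous_map (top_of_set (D1 \<times> I)) (subtopology X N) (\<lambda>p. \<phi> (xc (fst p)))"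
      by (simp add: o_def)
    from continuous_map_compose[OF c1(1) continuous_map_from_subtopology_mono[OF ycc D1Z]]
    have c3: "continuous_map (top_of_set (D1 \<times> I)) (cube i) (\<lambda>p. yc (fst p))"
      by (simp add: o_def)
    have "continuous_map (top_of_set (D1 \<times> I)) T (\<lambda>p. k ((yc (fst p), \<phi> (xc (fst p))), snd p))"
      using continuous_map_compose[OF continuous_map_pairedI[OF continuous_map_pairedI[OF c3 c2] c1(2)] k']
      by (simp add: o_def)
    moreover have "(D1 \<union> D2) \<times> I \<inter> D1 \<times> I = D1 \<times> I" by auto
    ultimately show "continuous_map (subtopology (top_of_set ((D1 \<union> D2) \<times> I)) (D1 \<times> I)) T
        (\<lambda>p. k ((yc (fst p), \<phi> (xc (fst p))), snd p))"
      by (simp only: subtopology_subtopology)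
    show "continuous_map (subtopology (top_of_set ((D1 \<union> D2) \<times> I)) (D2 \<times> I)) T (\<lambda>_. \<one>\<^bsub>G\<^esub>)"
      by (simp add: topT one)
    show "k ((yc (fst p), \<phi> (xc (fst p))), snd p) = \<one>\<^bsub>G\<^esub>" if "p \<in> D1 \<times> I" "p \<in> D2 \<times> I" for p
      using that D2_bd A_N \<phi>X AR_sub by (intro kb) (auto simp: D1_def)
  qed
  moreover have "k2 (z, 0) = \<one>\<^bsub>G\<^esub> \<and> k2 (z, 1) = F' z" if "z \<in> D1 \<union> D2" for z
  proof (cases "z \<in> D1")
    case True
    then show ?thesis
      using k0 k1 yc_cube A_N \<phi>X[OF xc_box] I01 by (auto simp: k2_def F'_def D1_def)
  next
    case False
    then have "z \<in> D2" "z \<in> Z" using that by (auto simp: D2_def)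
    then show ?thesis
      using False Fb[OF D2_bd \<phi>X[OF xc_box]] by (auto simp: k2_def F'_def)
  qed
  ultimately have k2: "nullhomotopy (top_of_set (D1 \<union> D2)) T \<one>\<^bsub>G\<^esub> F' k2"
    unfolding nullhomotopy_def I_def by simp
  have "\<exists>k'. nullhomotopy (top_of_set Z) T \<one>\<^bsub>G\<^esub> F' k' \<and>
      (\<forall>z\<in>D1 \<union> D2. \<forall>t\<in>{0..1}. k' (z, t) = k2 (z, t))"
    unfolding Z_def
    by (rule cellular_extension[OF G _ _ F'c[unfolded Z_def] _ closed_Un[OF closed_D1 closed_D2] sat k2])
      (use M' pi in \<open>auto simp: D1_def D2_def Z_def\<close>)
  then obtain K where K: "continuous_map (prod_topology (top_of_set Z) (top_of_set I)) T K"
    and K01: "\<And>z. z \<in> Z \<Longrightarrow> K (z, 0) = \<one>\<^bsub>G\<^esub> \<and> K (z, 1) = F' z"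
    and KD: "\<And>z t. z \<in> D1 \<union> D2 \<Longrightarrow> t \<in> I \<Longrightarrow> K (z, t) = k2 (z, t)"
    unfolding nullhomotopy_def I_def by auto

  \<comment> \<open>\<open>mg\<close> joins the cube coordinates and the rescaled chart coordinates
    of a point into one point of \<open>Z\<close>; \<open>yc\<close> and \<open>xc\<close> recover
    them.\<close>
  define mg where "mg p = (\<lambda>j. if j < i then fst p j else real M * \<psi> (snd p) (j - i))"
    for p :: "(nat \<Rightarrow> real) \<times> 'b"
  let ?L = "\<phi> ` unit_box n"
  have \<psi>_box: "\<psi> x \<in> unit_box n" "\<phi> (\<psi> x) = x" if "x \<in> ?L" for x using that \<psi> by auto
  have mg_Z: "mg (y, x) \<in> Z" if "y \<in> topspace (cube i)" "x \<in> ?L" for y x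
    unfolding Z_def
  proof (intro CollectI allI)
    fix j
    have "0 \<le> \<psi> x (j - i)" "\<psi> x (j - i) \<le> of_bool (j - i < n)"
      using \<psi>_box(1)[OF that(2)] by (auto simp: unit_box_def)
    moreover from this have "real M * \<psi> x (j - i) \<le> real M * of_bool (j - i < n)"
      by (intro mult_left_mono) auto
    moreover have "j < i \<Longrightarrow> 0 \<le> y j \<and> y j \<le> 1"
      using that(1) by (auto simp: topspace_cube PiE_iff)
    moreover have "\<not> j < i \<Longrightarrow> j - i < n \<longleftrightarrow> j < i + n" by auto
    ultimately show "0 \<le> mg (y, x) j \<and> mg (y, x) j \<le> real (M' j)"
      by (cases "j < i"; cases "j < i + n") (simp_all add: mg_def M'_def)
  qed
  have mg_yc: "yc (mg (y, x)) = y" if "y \<in> topspace (cube i)" for y x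
    using that by (auto simp: yc_def mg_def topspace_cube PiE_iff extensional_def)
  have mg_xc: "xc (mg (y, x)) = \<psi> x" for y x
    using M by (auto simp: xc_def mg_def)
  have mgc: "continuous_map (prod_topology (cube i) (subtopology X ?L)) (top_of_set Z) mg"
  proof -
    have "continuous_map (prod_topology (cube i) (subtopology X ?L)) euclideanreal (\<lambda>p. mg p j)" for j
    proof (cases "j < i")
      case True
      have "continuous_map (cube i) (top_of_set {0..1}) (\<lambda>w. w j)"
        unfolding cube_def using True by (intro continuous_map_product_projection) auto
      then have "continuous_map (cube i) euclideanreal (\<lambda>w. w j)"
        using continuous_map_into_fulltopology by blast
      from continuous_map_compose[OF continuous_map_fst this]
      show ?thesis using True by (simp add: mg_def o_def)
    next
      case False
      have "continuous_map (top_of_set (unit_box n)) euclideanreal (\<lambda>w. w (j - i))"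
        by (simp add: cont_coord)
      from continuous_map_compose[OF continuous_map_compose[OF continuous_map_snd \<psi>c] this]
      have "continuous_map (prod_topology (cube i) (subtopology X ?L)) euclideanreal (\<lambda>p. \<psi> (snd p) (j - i))"
        by (simp add: o_def)
      then show ?thesis using False by (simp add: mg_def continuous_map_real_mult_left)
    qed
    then have "continuous_map (prod_topology (cube i) (subtopology X ?L)) euclidean mg"
      unfolding euclidean_product_topology[symmetric] continuous_map_componentwise_UNIV by blast
    then show ?thesis using mg_Z by (auto simp: continuous_map_in_subtopology)
  qed
  define k3 where "k3 p = K (mg (fst p), snd p)" for p
  have k3c: "continuous_map (prod_topology (prod_topology (cube i) (subtopology X ?L)) (top_of_set I)) T k3"
    using continuous_map_compose[OF continuous_map_pairedI[OF
      continuous_map_compose[OF continuous_map_fst mgc] continuous_map_snd] K]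
    by (simp add: o_def k3_def[abs_def])
  have k3A: "k3 ((y, \<phi> w), t) = k ((y, \<phi> w), t)" if "y \<in> topspace (cube i)" "w \<in> A" "t \<in> I" for y w t
  proof -
    have w: "w \<in> unit_box n" using that AR_sub by auto
    then have "mg (y, \<phi> w) \<in> D1"
      using mg_Z[OF that(1), of "\<phi> w"] mg_xc[of y "\<phi> w"] \<psi>[of w] that by (auto simp: D1_def)
    then show ?thesis
      using KD[of "mg (y, \<phi> w)" t] that mg_yc mg_xc \<psi>[OF w] by (simp add: k3_def k2_def)
  qed
  have k3b: "k3 ((y, x), t) = \<one>\<^bsub>G\<^esub>" if "y \<in> cube_boundary i" "x \<in> ?L" "t \<in> I" for y x t
  proof -
    have y: "y \<in> topspace (cube i)" using that by (auto simp: cube_boundary_def)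
    have "mg (y, x) \<in> D2"
      using mg_Z[OF y that(2)] that(1) by (auto simp: D2_def cube_boundary_def mg_def)
    then have "k3 ((y, x), t) = k2 (mg (y, x), t)" using KD[of "mg (y, x)" t] that by (simp add: k3_def)
    also have "\<dots> = \<one>\<^bsub>G\<^esub>"
      using kb[OF that(1), of "\<phi> (\<psi> x)" t] A_N[of "\<psi> x"] \<phi>X[of "\<psi> x"] \<psi>_box(1)[OF that(2)] that(3)
      by (simp add: k2_def mg_yc[OF y] mg_xc D1_def)
    finally show ?thesis .
  qed

  define N0 where "N0 = N - \<phi> ` R"
  define O' where "O' = \<phi> ` open_unit_box n"
  define k4 where "k4 p = (if snd (fst p) \<in> N0 then k p else k3 p)" for p
  have "openin X N0"
    unfolding N0_def using N chart_box_closedin(1)[OF X \<phi> AR_sub(2) closed_AR(2)] by (rule openin_diff)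
  have "openin X O'" unfolding O'_def by (rule \<phi>o)
  have N0_N: "N0 \<subseteq> N" by (auto simp: N0_def)
  have O'L: "O' \<subseteq> ?L" by (auto simp: O'_def open_unit_box_def)
  have C_N0: "C \<subseteq> N0"
  proof
    fix x assume x: "x \<in> C"
    have "x \<notin> \<phi> ` R"
      using x R_C AR_sub by (auto simp: C'_def)
    then show "x \<in> N0" using x C(2) by (auto simp: N0_def)
  qed
  define S where "S B = prod_topology (prod_topology (cube i) (subtopology X B)) (top_of_set I)" for B
  define W where "W B = {p \<in> topspace (S (N0 \<union> O')). snd (fst p) \<in> B}" for B
  have proj: "continuous_map (S (N0 \<union> O')) X (\<lambda>p. snd (fst p))"
  proof -
    have "continuous_map (S (N0 \<union> O')) (subtopology X (N0 \<union> O')) (\<lambda>p. snd (fst p))"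
      unfolding S_def using continuous_map_compose[OF continuous_map_fst continuous_map_snd]
      by (simp add: o_def)
    then show ?thesis using continuous_map_into_fulltopology by blast
  qed
  have openW: "openin (S (N0 \<union> O')) (W B)" if "openin X B" for B
    unfolding W_def using openin_continuous_map_preimage[OF proj that] .
  have subW: "subtopology (S (N0 \<union> O')) (W B) = S B" if "B \<subseteq> N0 \<union> O'" for B
  proof -
    have "subtopology (S (N0 \<union> O')) (W B) = subtopology (S (N0 \<union> O')) {p. snd (fst p) \<in> B}"
    proof -
      have "W B = topspace (S (N0 \<union> O')) \<inter> {p. snd (fst p) \<in> B}" by (auto simp: W_def)
      then show ?thesis by (simp only: subtopology_restrict)
    qed
    also have "\<dots> = S B"
      unfolding S_def slab_eq subtopology_subtopology
      by (rule arg_cong[where f = "subtopology _"]) (use that in auto)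
    finally show ?thesis .
  qed
  have S_mono: "continuous_map (S B) T f" if "continuous_map (S B') T f" "B \<subseteq> B'" for B B' f
    using that(1) unfolding S_def slab_eq
    by (rule continuous_map_from_subtopology_mono) (use that(2) in auto)
  have "continuous_map (S (N0 \<union> O')) T (\<lambda>p. if p \<in> W N0 then k p else k3 p)"
  proof (rule continuous_map_paste_open)
    show "openin (S (N0 \<union> O')) (W N0)" "openin (S (N0 \<union> O')) (W O')"
      using openW \<open>openin X N0\<close> \<open>openin X O'\<close> by auto
    show "topspace (S (N0 \<union> O')) \<subseteq> W N0 \<union> W O'"
      by (auto simp: W_def S_def)
    show "continuous_map (subtopology (S (N0 \<union> O')) (W N0)) T k"
      using S_mono[OF k'[folded S_def], of N0] subW[of N0] N0_N by simp
    show "continuous_map (subtopology (S (N0 \<union> O')) (W O')) T k3"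
      using S_mono[OF k3c[folded S_def], of O'] subW[of O'] O'L by simp
    show "k p = k3 p" if p: "p \<in> W N0" "p \<in> W O'" for p
    proof -
      obtain y x t where pe: "p = ((y, x), t)" by (metis prod.exhaust)
      have y: "y \<in> topspace (cube i)" "t \<in> I" "x \<in> N0" "x \<in> O'"
        using p by (auto simp: W_def S_def pe)
      then obtain w where w: "x = \<phi> w" "w \<in> unit_box n" using O'L by auto
      \<comment> \<open>Points of \<open>N0\<close> avoid the image of \<open>R\<close>, so a chart
        point there can only come from \<open>A\<close>.\<close>
      then have "w \<in> A" using AR[OF w(2)] y(3) by (auto simp: N0_def)
      then show ?thesis using k3A[OF y(1) _ y(2)] by (simp add: pe w)
    qed
  qed
  then have "continuous_map (S (N0 \<union> O')) T k4"
    by (rule continuous_map_eq) (auto simp: k4_def W_def)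
  moreover have "k4 ((y, x), 0) = \<one>\<^bsub>G\<^esub> \<and> k4 ((y, x), 1) = F (y, x)"
    if y: "y \<in> topspace (cube i)" and x: "x \<in> topspace X" "x \<in> N0 \<union> O'" for y x
  proof (cases "x \<in> N0")
    case True
    then show ?thesis using k0[OF y x(1)] k1[OF y x(1)] by (auto simp: k4_def N0_def)
  next
    case False
    then have xL: "x \<in> ?L" using x O'L by auto
    then show ?thesis
      using K01[OF mg_Z[OF y xL]] False mg_yc[OF y] mg_xc \<psi>_box[OF xL]
      by (simp add: k4_def k3_def F'_def)
  qed
  moreover have "k4 ((y, x), t) = \<one>\<^bsub>G\<^esub>"
    if "y \<in> cube_boundary i" "x \<in> topspace X" "x \<in> N0 \<union> O'" "t \<in> I" for y x t
    using that kb[of y x t] k3b[of y x t] O'L by (auto simp: k4_def N0_def)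
  ultimately have "partial_nullhomotopy i X T \<one>\<^bsub>G\<^esub> F (N0 \<union> O') k4"
    unfolding partial_nullhomotopy_def nullhomotopy_def S_def I_def by auto
  moreover have "k4 ((y, x), t) = k ((y, x), t)" if "x \<in> C" for y x t
    using that C_N0 by (auto simp: k4_def)
  moreover have "openin X (N0 \<union> O')"
    using \<open>openin X N0\<close> \<open>openin X O'\<close> by (rule openin_Un)
  moreover have "C \<union> \<phi> ` open_unit_box n \<subseteq> N0 \<union> O'"
    using C_N0 by (auto simp: O'_def)
  ultimately show ?thesis by (intro that[of "N0 \<union> O'" k4])
qed

section \<open>Coordinate cubes in a topological manifold\<close>

lemma Euclidean_space_box_nhd:
  assumes "openin (Euclidean_space n) V" "v \<in> V"
  obtains \<delta> where "0 < \<delta>"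
    "\<And>z. (\<And>j. j < n \<Longrightarrow> \<bar>z j - v j\<bar> \<le> \<delta>) \<Longrightarrow> (\<And>j. n \<le> j \<Longrightarrow> z j = 0) \<Longrightarrow> z \<in> V"
proof -
  obtain W where W: "openin (powertop_real UNIV) W" "V = W \<inter> {x. \<forall>i\<ge>n. x i = 0}"
    using assms(1) by (auto simp: Euclidean_space_def openin_subtopology)
  then obtain Y where Y: "v \<in> (\<Pi>\<^sub>E j\<in>UNIV. Y j)" "\<And>j. open (Y j)" "(\<Pi>\<^sub>E j\<in>UNIV. Y j) \<subseteq> W"
    using product_topology_open_contains_basis[of "\<lambda>_. euclideanreal" UNIV W v] assms(2) by auto
  have "\<exists>e>0. \<forall>y. \<bar>y - v j\<bar> < e \<longrightarrow> y \<in> Y j" for j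
    using Y(1) Y(2)[of j] unfolding open_dist dist_real_def by (auto simp: PiE_iff)
  then obtain \<epsilon> where \<epsilon>: "\<And>j. 0 < \<epsilon> j" "\<And>j y. \<bar>y - v j\<bar> < \<epsilon> j \<Longrightarrow> y \<in> Y j" by metis
  \<comment> \<open>The 1 covers \<open>n = 0\<close>. Halving gives a radius strictly below each
    \<open>\<epsilon> j\<close> with \<open>j < n\<close>, so closed inequalities suffice; in the
    remaining coordinates \<open>z\<close> and \<open>v\<close> are both 0.\<close>
  define \<delta> where "\<delta> = Min (insert 1 (\<epsilon> ` {..<n})) / 2"
  have m: "0 < Min (insert 1 (\<epsilon> ` {..<n}))" using \<epsilon> by (subst Min_gr_iff) auto
  show ?thesis
  proof
    show "0 < \<delta>" using m by (simp add: \<delta>_def)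
    fix z assume z: "\<And>j. j < n \<Longrightarrow> \<bar>z j - v j\<bar> \<le> \<delta>" "\<And>j. n \<le> j \<Longrightarrow> z j = 0"
    have v0: "v j = 0" if "n \<le> j" for j using assms(2) W(2) that by auto
    have "z j \<in> Y j" for j
    proof (rule \<epsilon>(2), cases "j < n")
      case True
      have "Min (insert 1 (\<epsilon> ` {..<n})) \<le> \<epsilon> j" using True by (intro Min_le) auto
      then have "\<delta> < \<epsilon> j" unfolding \<delta>_def using m by linarith
      then show "\<bar>z j - v j\<bar> < \<epsilon> j" using z(1)[OF True] by simp
    next
      case False
      then show "\<bar>z j - v j\<bar> < \<epsilon> j" using z(2)[of j] v0[of j] \<epsilon>(1)[of j] by simp
    qed
    then have "z \<in> W" using Y(3) by (auto simp: PiE_iff)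
    then show "z \<in> V" using W(2) z(2) by auto
  qed
qed

text \<open>\<open>x\<close> is placed at the centre of the cube so that the interiors of concentric
  smaller cubes still cover the manifold.\<close>

lemma manifold_chart_box:
  assumes "topological_manifold n X" "x \<in> topspace X"
  obtains \<phi> where "chart_box n X \<phi>" "x = \<phi> (\<lambda>j. of_bool (j < n) / 2)"
proof -
  obtain U V where U: "openin X U" "x \<in> U" and V: "openin (Euclidean_space n) V"
    and "subtopology X U homeomorphic_space subtopology (Euclidean_space n) V"
    using assms unfolding topological_manifold_def by metis
  then obtain h g where "homeomorphic_maps (subtopology X U) (subtopology (Euclidean_space n) V) h g"
    unfolding homeomorphic_space_def by blast
  moreover have "topspace (subtopology X U) = U" "topspace (subtopology (Euclidean_space n) V) = V"
    using U(1) V openin_subset by fastforce+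
  ultimately have hc: "continuous_map (subtopology X U) (subtopology (Euclidean_space n) V) h"
    and gc: "continuous_map (subtopology (Euclidean_space n) V) (subtopology X U) g"
    and gh: "\<And>x. x \<in> U \<Longrightarrow> g (h x) = x" and hg: "\<And>z. z \<in> V \<Longrightarrow> h (g z) = z"
    and top: "topspace (subtopology X U) = U" "topspace (subtopology (Euclidean_space n) V) = V"
    unfolding homeomorphic_maps_def by auto
  have hV: "h y \<in> V" if "y \<in> U" for y
    using continuous_map_image_subset_topspace[OF hc] that unfolding top by blast
  have gU: "g z \<in> U" if "z \<in> V" for z
    using continuous_map_image_subset_topspace[OF gc] that unfolding top by blast
  define v where "v = h x"
  have v: "v \<in> V" using hV U(2) by (simp add: v_def)
  have V0: "z j = 0" if "z \<in> V" "n \<le> j" for z j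
    using openin_subset[OF V] that by (auto simp: topspace_Euclidean_space)
  obtain \<delta> where \<delta>: "0 < \<delta>"
    and box: "\<And>z. (\<And>j. j < n \<Longrightarrow> \<bar>z j - v j\<bar> \<le> \<delta>) \<Longrightarrow> (\<And>j. n \<le> j \<Longrightarrow> z j = 0) \<Longrightarrow> z \<in> V"
    using Euclidean_space_box_nhd[OF V v] by blast
  \<comment> \<open>Affine map of the unit cube onto the box of radius \<open>\<delta>\<close> about
    \<open>v\<close>; the \<open>of_bool\<close> keeps the coordinates from \<open>n\<close> on at
    0.\<close>
  define a where "a z = (\<lambda>j. v j + 2 * \<delta> * (z j - of_bool (j < n) / 2))" for z :: "nat \<Rightarrow> real"
  have aV: "a z \<in> V" if z: "z \<in> unit_box n" for z
  proof (rule box)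
    fix j
    have zj: "0 \<le> z j" "z j \<le> of_bool (j < n)" using z by (auto simp: unit_box_def)
    show "a z j = 0" if "n \<le> j" using zj V0[OF v that] that by (simp add: a_def)
    show "\<bar>a z j - v j\<bar> \<le> \<delta>" if "j < n"
    proof -
      have "\<bar>z j - 1/2\<bar> \<le> 1/2" using zj that unfolding abs_le_iff by simp
      then have "2 * \<delta> * \<bar>z j - 1/2\<bar> \<le> 2 * \<delta> * (1/2)" using \<delta> by (intro mult_left_mono) auto
      then show ?thesis using that \<delta> by (simp add: a_def abs_mult)
    qed
  qed
  have "continuous_on (unit_box n) a"
    unfolding a_def
    by (intro continuous_on_coordinatewise_then_product continuous_on_add continuous_on_mult
        continuous_on_diff continuous_on_const
        continuous_on_product_then_coordinatewise[OF continuous_on_id])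
  then have "continuous_map (top_of_set (unit_box n)) (subtopology (Euclidean_space n) V) a"
    using aV V0 unfolding Euclidean_space_def euclidean_product_topology
    by (auto simp: continuous_map_in_subtopology)
  from continuous_map_compose[OF this gc]
  have \<phi>c: "continuous_map (top_of_set (unit_box n)) X (\<lambda>z. g (a z))"
    using continuous_map_into_fulltopology by (auto simp: o_def)
  have "inj_on (\<lambda>z. g (a z)) (unit_box n)"
  proof (rule inj_onI)
    fix z w assume zw: "z \<in> unit_box n" "w \<in> unit_box n" "g (a z) = g (a w)"
    then have "a z = a w" using hg aV by metis
    then have "a z j = a w j" for j by simp
    then show "z = w" using \<delta> by (auto simp: a_def)
  qed
  moreover have "openin X ((\<lambda>z. g (a z)) ` open_unit_box n)"
  proof -
    \<comment> \<open>The same set described through \<open>h\<close>, so that its openness follows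
      from the continuity of finitely many coordinates of \<open>h\<close>.\<close>
    define O' where "O' = {y \<in> U. \<forall>j<n. \<bar>h y j - v j\<bar> < \<delta>}"
    have "continuous_map (subtopology X U) euclidean h"
      using continuous_map_into_fulltopology[OF continuous_map_into_fulltopology[OF hc[unfolded Euclidean_space_def]]]
      by (simp add: euclidean_product_topology)
    then have hj: "continuous_map (subtopology X U) euclideanreal (\<lambda>y. h y j)" for j
      unfolding euclidean_product_topology[symmetric] continuous_map_componentwise_UNIV by blast
    have "openin (subtopology X U) {y \<in> topspace (subtopology X U). h y j \<in> ball (v j) \<delta>}" for j
      by (rule openin_continuous_map_preimage[OF hj]) simp
    then have "openin (subtopology X U)
        ((\<Inter>j\<in>{..<n}. {y \<in> topspace (subtopology X U). h y j \<in> ball (v j) \<delta>}) \<inter> topspace (subtopology X U))"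
      by (intro openin_INT) auto
    moreover have "(\<Inter>j\<in>{..<n}. {y \<in> topspace (subtopology X U). h y j \<in> ball (v j) \<delta>}) \<inter>
        topspace (subtopology X U) = O'"
      using openin_subset[OF U(1)] by (auto simp: O'_def dist_real_def abs_minus_commute)
    ultimately have "openin X O'"
      using U(1) openin_open_subtopology by metis
    moreover have "(\<lambda>z. g (a z)) ` open_unit_box n = O'"
    proof (intro equalityI subsetI)
      fix y assume "y \<in> (\<lambda>z. g (a z)) ` open_unit_box n"
      then obtain z where z: "z \<in> unit_box n" "\<And>j. j < n \<Longrightarrow> 0 < z j \<and> z j < 1" "y = g (a z)"
        by (auto simp: open_unit_box_def)
      have "\<bar>a z j - v j\<bar> < \<delta>" if "j < n" for j
      proof -
        have "\<bar>z j - 1/2\<bar> < 1/2" using z(2)[OF that] unfolding abs_less_iff by simp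
        then have "2 * \<delta> * \<bar>z j - 1/2\<bar> < 2 * \<delta> * (1/2)" using \<delta> by (intro mult_strict_left_mono) auto
        then show ?thesis using that \<delta> by (simp add: a_def abs_mult)
      qed
      then show "y \<in> O'" using z aV[OF z(1)] gU hg by (auto simp: O'_def)
    next
      fix y assume y: "y \<in> O'"
      then have yU: "y \<in> U" by (simp add: O'_def)
      define z where "z j = (if j < n then (h y j - v j) / (2 * \<delta>) + 1/2 else 0)" for j
      have "0 < z j \<and> z j < 1" if "j < n" for j
      proof -
        have "\<bar>h y j - v j\<bar> < \<delta>" using y that by (auto simp: O'_def)
        then show ?thesis using that \<delta> by (auto simp: z_def field_simps abs_less_iff)
      qed
      then have "z \<in> open_unit_box n"
        by (auto simp: open_unit_box_def unit_box_def z_def less_imp_le)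
      moreover have "a z = h y"
      proof
        fix j show "a z j = h y j"
          using \<delta> V0[OF v, of j] V0[OF hV[OF yU], of j] by (auto simp: a_def z_def)
      qed
      ultimately show "y \<in> (\<lambda>z. g (a z)) ` open_unit_box n"
        using gh[OF yU] by (intro image_eqI[of _ _ z]) auto
    qed
    ultimately show ?thesis by simp
  qed
  ultimately have "chart_box n X (\<lambda>z. g (a z))" using \<phi>c by (simp add: chart_box_def)
  moreover have "a (\<lambda>j. of_bool (j < n) / 2) = v" by (simp add: a_def)
  then have "x = g (a (\<lambda>j. of_bool (j < n) / 2))" using gh[OF U(2)] by (simp add: v_def)
  ultimately show ?thesis by (rule that)
qed

text \<open>Openness of the image of the whole open cube is part of \<open>chart_box\<close>;
  smaller open sets are cut out by the continuous inverse.\<close>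

lemma chart_box_openin:
  assumes X: "Hausdorff_space X" and \<phi>: "chart_box n X \<phi>" and W: "open W"
  shows "openin X (\<phi> ` (open_unit_box n \<inter> W))"
proof -
  obtain \<psi> where \<psi>c: "continuous_map (subtopology X (\<phi> ` unit_box n)) (top_of_set (unit_box n)) \<psi>"
    and \<psi>: "\<And>z. z \<in> unit_box n \<Longrightarrow> \<psi> (\<phi> z) = z"
    using chart_box_inverse[OF X \<phi>] by blast
  have sub: "open_unit_box n \<subseteq> unit_box n" by (auto simp: open_unit_box_def)
  have top: "topspace (subtopology X (\<phi> ` unit_box n)) = \<phi> ` unit_box n"
    using \<phi> continuous_map_image_subset_topspace[of "top_of_set (unit_box n)" X \<phi>]
    by (auto simp: chart_box_def)
  have "continuous_map (subtopology X (\<phi> ` unit_box n)) euclidean \<psi>"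
    using \<psi>c continuous_map_into_fulltopology by blast
  from openin_continuous_map_preimage[OF this, of W] W
  have "openin (subtopology X (\<phi> ` unit_box n)) {x \<in> \<phi> ` unit_box n. \<psi> x \<in> W}"
    by (simp only: top open_openin)
  then obtain S where S: "openin X S" "{x \<in> \<phi> ` unit_box n. \<psi> x \<in> W} = S \<inter> \<phi> ` unit_box n"
    unfolding openin_subtopology by auto
  have "\<phi> ` (open_unit_box n \<inter> W) = \<phi> ` open_unit_box n \<inter> S"
  proof (intro equalityI subsetI)
    fix x assume "x \<in> \<phi> ` (open_unit_box n \<inter> W)"
    then obtain z where z: "x = \<phi> z" "z \<in> open_unit_box n" "z \<in> W" by auto
    then have "x \<in> {x \<in> \<phi> ` unit_box n. \<psi> x \<in> W}" using sub \<psi> by auto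
    then show "x \<in> \<phi> ` open_unit_box n \<inter> S" using S(2) z by auto
  next
    fix x assume x: "x \<in> \<phi> ` open_unit_box n \<inter> S"
    then obtain z where z: "x = \<phi> z" "z \<in> open_unit_box n" by auto
    then have "x \<in> {x \<in> \<phi> ` unit_box n. \<psi> x \<in> W}" using S(2) x sub by auto
    then have "z \<in> W" using \<psi>[of z] z sub by auto
    then show "x \<in> \<phi> ` (open_unit_box n \<inter> W)" using z by auto
  qed
  then show ?thesis using S(1) \<phi> by (auto simp: chart_box_def)
qed

text \<open>By the Lindelof property countably many small open cubes \<open>W\<close> cover
  \<open>X\<close>. Each stage preserves the values on the closed cubes \<open>K\<close> treated
  before, so near each point the sequence is eventually constant; on the cube \<open>W\<close> of
  chart \<open>l\<close>, stage \<open>Suc l\<close> already is the limit.\<close>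

theorem manifold_nullhomotopy:
  assumes G: "topological_group G T" and X: "topological_manifold n X"
    and pi: "\<And>m. m \<le> i + n \<Longrightarrow> trivial_group (group_pi G T m)"
    and F: "continuous_map (prod_topology (cube i) X) T F"
    and Fb: "\<And>y x. y \<in> cube_boundary i \<Longrightarrow> x \<in> topspace X \<Longrightarrow> F (y, x) = \<one>\<^bsub>G\<^esub>"
  obtains k where "partial_nullhomotopy i X T \<one>\<^bsub>G\<^esub> F (topspace X) k"
proof -
  have H: "Hausdorff_space X" and sc: "second_countable X"
    using X by (auto simp: topological_manifold_def second_countable_def)
  have topT: "topspace T = carrier G" and one: "\<one>\<^bsub>G\<^esub> \<in> carrier G"
    using G by (auto simp: topological_group_def group.is_monoid monoid.one_closed)
  \<comment> \<open>\<open>r\<close> measures the distance from the centre; the radius 1/4 is below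
    the half-width 1/2, leaving room between the small closed cubes and the boundary of the
    chart.\<close>
  define r where "r z = max_norm {..<n} (\<lambda>j. z j - 1/2)" for z :: "nat \<Rightarrow> real"
  have r_cont: "continuous_on UNIV r"
    unfolding r_def
    by (intro continuous_intros finite_lessThan continuous_on_product_coordinates)
  have r_less: "z \<in> open_unit_box n" if "z \<in> unit_box n" "r z \<le> 1/4" for z
  proof -
    have *: "\<bar>z j - 1/2\<bar> \<le> 1/4" if "j < n" for j
      using max_norm_ge[of "{..<n}" j "\<lambda>j. z j - 1/2"] that \<open>r z \<le> 1/4\<close> by (simp add: r_def)
    then have "0 < z j \<and> z j < 1" if "j < n" for j
      using *[OF that] unfolding abs_le_iff by linarith
    then show ?thesis using that(1) by (simp add: open_unit_box_def)
  qed
  define W where "W \<phi> = \<phi> ` (open_unit_box n \<inter> {z. r z < 1/4})" for \<phi> :: "(nat \<Rightarrow> real) \<Rightarrow> 'b"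
  define K where "K \<phi> = \<phi> ` {z \<in> unit_box n. r z \<le> 1/4}" for \<phi> :: "(nat \<Rightarrow> real) \<Rightarrow> 'b"
  have W_open: "openin X (W \<phi>)" if "chart_box n X \<phi>" for \<phi>
    unfolding W_def by (intro chart_box_openin[OF H that] open_Collect_less r_cont continuous_on_const)
  have K_closed: "closedin X (K \<phi>)" if "chart_box n X \<phi>" for \<phi>
  proof -
    have "{z \<in> unit_box n. r z \<le> 1/4} = unit_box n \<inter> {z. r z \<le> 1/4}" by auto
    then have "closed {z \<in> unit_box n. r z \<le> 1/4}"
      using closed_Int[OF closed_unit_box closed_Collect_le[OF r_cont continuous_on_const]] by (simp only:)
    then show ?thesis
      unfolding K_def using chart_box_closedin(1)[OF H that, of "{z \<in> unit_box n. r z \<le> 1/4}"] by auto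
  qed
  have WK: "W \<phi> \<subseteq> K \<phi>" for \<phi> by (auto simp: W_def K_def open_unit_box_def)
  have KO: "K \<phi> \<subseteq> \<phi> ` open_unit_box n" for \<phi> using r_less by (auto simp: K_def)
  have "\<exists>\<phi>. chart_box n X \<phi> \<and> x \<in> W \<phi>" if x: "x \<in> topspace X" for x
  proof -
    obtain \<phi> where \<phi>: "chart_box n X \<phi>" "x = \<phi> (\<lambda>j. of_bool (j < n) / 2)"
      using manifold_chart_box[OF X x] by blast
    let ?z = "\<lambda>j. of_bool (j < n) / 2 :: real"
    have "r ?z \<le> 0" unfolding r_def by (subst max_norm_le_iff) auto
    moreover have "?z \<in> unit_box n" by (auto simp: unit_box_def)
    ultimately have "x \<in> W \<phi>" using r_less[of ?z] \<phi>(2) by (auto simp: W_def)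
    then show ?thesis using \<phi>(1) by blast
  qed
  then have "\<Union>(W ` {\<phi>. chart_box n X \<phi>}) = topspace X"
    using W_open openin_subset by (intro equalityI subsetI) (blast, force)
  moreover have "\<And>U. U \<in> W ` {\<phi>. chart_box n X \<phi>} \<Longrightarrow> openin X U" using W_open by auto
  ultimately have "\<exists>\<V>. countable \<V> \<and> \<V> \<subseteq> W ` {\<phi>. chart_box n X \<phi>} \<and> \<Union>\<V> = topspace X"
    using Lindelof_spaceD[OF second_countable_imp_Lindelof_space[OF sc]] by metis
  then obtain \<V> where \<V>: "countable \<V>" "\<V> \<subseteq> W ` {\<phi>. chart_box n X \<phi>}" "\<Union>\<V> = topspace X"
    by metis
  \<comment> \<open>An empty cover means that \<open>X\<close> is empty; otherwise
    \<open>from_nat_into\<close> enumerates the cover, repetitions allowed.\<close>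
  show ?thesis
  proof (cases "\<V> = {}")
    case True
    then have "topspace X = {}" using \<V>(3) by auto
    then show ?thesis
      by (intro that[of "\<lambda>_. \<one>\<^bsub>G\<^esub>"]) (simp add: partial_nullhomotopy_def nullhomotopy_def topT one)
  next
    case False
    have "\<exists>\<phi>. chart_box n X \<phi> \<and> from_nat_into \<V> l = W \<phi>" for l
      using from_nat_into[OF False, of l] \<V>(2) by auto
    then obtain \<Phi> where \<Phi>: "\<And>l. chart_box n X (\<Phi> l)" "\<And>l. from_nat_into \<V> l = W (\<Phi> l)" by metis
    have cover: "topspace X = (\<Union>l. W (\<Phi> l))"
      using \<V>(3) \<Phi>(2) range_from_nat_into[OF False \<V>(1)] by (metis image_cong)
    define C where "C l = (\<Union>m\<in>{..<l}. K (\<Phi> m))" for l :: nat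
    have C_closed: "closedin X (C l)" for l
      unfolding C_def using K_closed \<Phi>(1) by (intro closedin_Union) auto
    \<comment> \<open>A stage is a pair of an open domain and a nullhomotopy. The domains need not
      increase; only the closed sets \<open>C l\<close> do, and agreement is demanded on
      these.\<close>
    have "\<exists>f. \<forall>l. (openin X (fst (f l)) \<and> C l \<subseteq> fst (f l) \<and>
          partial_nullhomotopy i X T \<one>\<^bsub>G\<^esub> F (fst (f l)) (snd (f l))) \<and>
        (\<forall>x\<in>C l. \<forall>y t. snd (f (Suc l)) ((y, x), t) = snd (f l) ((y, x), t))"
    proof (rule dependent_nat_choice)
      show "\<exists>f. openin X (fst f) \<and> C 0 \<subseteq> fst f \<and> partial_nullhomotopy i X T \<one>\<^bsub>G\<^esub> F (fst f) (snd f)"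
        by (intro exI[of _ "({}, \<lambda>_. \<one>\<^bsub>G\<^esub>)"])
          (simp add: C_def partial_nullhomotopy_def nullhomotopy_def topT one)
      fix f l
      assume f: "openin X (fst f) \<and> C l \<subseteq> fst f \<and> partial_nullhomotopy i X T \<one>\<^bsub>G\<^esub> F (fst f) (snd f)"
      obtain N' k' where *: "openin X N'" "C l \<union> \<Phi> l ` open_unit_box n \<subseteq> N'"
          "partial_nullhomotopy i X T \<one>\<^bsub>G\<^esub> F N' k'"
          "\<And>y x t. x \<in> C l \<Longrightarrow> k' ((y, x), t) = snd f ((y, x), t)"
        using chart_box_extension[OF G H \<Phi>(1)[of l] pi F Fb _ C_closed[of l], of "fst f" "snd f"] f by metis
      have "C (Suc l) \<subseteq> C l \<union> \<Phi> l ` open_unit_box n"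
        using KO[of "\<Phi> l"] by (auto simp: C_def lessThan_Suc)
      then have "C (Suc l) \<subseteq> N'" using *(2) by (rule order_trans)
      then show "\<exists>f'. (openin X (fst f') \<and> C (Suc l) \<subseteq> fst f' \<and>
            partial_nullhomotopy i X T \<one>\<^bsub>G\<^esub> F (fst f') (snd f')) \<and>
          (\<forall>x\<in>C l. \<forall>y t. snd f' ((y, x), t) = snd f ((y, x), t))"
        using * by (intro exI[of _ "(N', k')"]) simp
    qed
    then obtain f where f: "\<And>l. C l \<subseteq> fst (f l)"
      "\<And>l. partial_nullhomotopy i X T \<one>\<^bsub>G\<^esub> F (fst (f l)) (snd (f l))"
      and fS: "\<And>l x y t. x \<in> C l \<Longrightarrow> snd (f (Suc l)) ((y, x), t) = snd (f l) ((y, x), t)"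
      by blast
    have C_mono: "C l \<subseteq> C m" if "l \<le> m" for l m
      unfolding C_def by (rule UN_mono) (use that in auto)
    have stable: "snd (f m) ((y, x), t) = snd (f l) ((y, x), t)" if "l \<le> m" "x \<in> C l" for l m x y t
      using that(1)
    proof (induction m rule: dec_induct)
      case (step m)
      then show ?case using fS[of x m] C_mono[of l m] that(2) by auto
    qed simp
    define S where "S = prod_topology (prod_topology (cube i) X) (top_of_set {0..1::real})"
    define D where "D l = {p \<in> topspace S. snd (fst p) \<in> W (\<Phi> l)}" for l
    have WC: "W (\<Phi> l) \<subseteq> C (Suc l)" for l using WK[of "\<Phi> l"] by (auto simp: C_def)
    obtain k where k: "continuous_map S T k"
      and kf: "\<And>l p. p \<in> topspace S \<inter> D l \<Longrightarrow> k p = snd (f (Suc l)) p"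
    proof (rule pasting_lemma_exists[where X = S and I = UNIV and T = D and Y = T
        and f = "\<lambda>l. snd (f (Suc l))"])
      show "topspace S \<subseteq> (\<Union>l\<in>UNIV. D l)"
        using cover by (auto simp: D_def S_def)
      have "continuous_map S X (\<lambda>p. snd (fst p))"
        unfolding S_def using continuous_map_compose[OF continuous_map_fst continuous_map_snd]
        by (simp add: o_def)
      then show "openin S (D l)" for l
        unfolding D_def using W_open[OF \<Phi>(1)] by (rule openin_continuous_map_preimage)
      show "continuous_map (subtopology S (D l)) T (snd (f (Suc l)))" for l
      proof -
        have "continuous_map (subtopology S {p. snd (fst p) \<in> fst (f (Suc l))}) T (snd (f (Suc l)))"
          using f(2)[of "Suc l"] unfolding partial_nullhomotopy_def nullhomotopy_def slab_eq S_def by blast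
        then show ?thesis
          by (rule continuous_map_from_subtopology_mono) (use WC[of l] f(1)[of "Suc l"] in \<open>auto simp: D_def\<close>)
      qed
      \<comment> \<open>Both stages agree at \<open>p\<close> with the later of the two.\<close>
      show "snd (f (Suc l)) p = snd (f (Suc m)) p" if "p \<in> topspace S \<inter> D l \<inter> D m" for l m p
      proof -
        obtain y x t where p: "p = ((y, x), t)" by (metis prod.exhaust)
        have "x \<in> C (Suc l)" "x \<in> C (Suc m)" using that WC by (auto simp: D_def p)
        then have "snd (f (max (Suc l) (Suc m))) p = snd (f (Suc l)) p"
          "snd (f (max (Suc l) (Suc m))) p = snd (f (Suc m)) p"
          unfolding p by (intro stable; simp)+
        then show ?thesis by simp
      qed
    qed (metis UNIV_I)
    have "k ((y, x), 0) = \<one>\<^bsub>G\<^esub> \<and> k ((y, x), 1) = F (y, x) \<and>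
        (y \<in> cube_boundary i \<longrightarrow> (\<forall>t\<in>{0..1}. k ((y, x), t) = \<one>\<^bsub>G\<^esub>))"
      if y: "y \<in> topspace (cube i)" and x: "x \<in> topspace X" for y x
    proof -
      obtain l where l: "x \<in> W (\<Phi> l)" using x cover by auto
      then have "k ((y, x), t) = snd (f (Suc l)) ((y, x), t)" if "t \<in> {0..1}" for t
        using kf[of "((y, x), t)" l] y x that by (auto simp: D_def S_def)
      moreover have "x \<in> fst (f (Suc l))" using l WC f(1)[of "Suc l"] by blast
      ultimately show ?thesis
        using f(2)[of "Suc l"] x y by (auto simp: partial_nullhomotopy_def nullhomotopy_def)
    qed
    then have "partial_nullhomotopy i X T \<one>\<^bsub>G\<^esub> F (topspace X) k"
      using k unfolding partial_nullhomotopy_def nullhomotopy_def S_def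
      by (auto simp: cube_boundary_def)
    then show ?thesis by (rule that)
  qed
qed

section \<open>Trivial rational homotopy groups\<close>

text \<open>The relator with both left factors equal to the unit is minus the generator
  \<open>(1, b)\<close>, so every generator lies in the kernel. The hypotheses on \<open>A\<close>
  are stated for a bare record so that they can be checked for \<open>group_pi\<close> directly from
  its definition.\<close>

lemma tensor_product_trivial:
  assumes A: "carrier A = {\<one>\<^bsub>A\<^esub>}" "\<one>\<^bsub>A\<^esub> \<otimes>\<^bsub>A\<^esub> \<one>\<^bsub>A\<^esub> = \<one>\<^bsub>A\<^esub>"
    and B: "\<And>b b'. b \<in> carrier B \<Longrightarrow> b' \<in> carrier B \<Longrightarrow> b \<otimes>\<^bsub>B\<^esub> b' \<in> carrier B"
  shows "trivial_group (tensor_product A B)"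
proof -
  let ?F = "free_Abelian_group (carrier A \<times> carrier B)"
  interpret F: comm_group ?F by (rule abelian_free_Abelian_group)
  have of_mem: "frag_of (\<one>\<^bsub>A\<^esub>, b) \<in> carrier ?F" if "b \<in> carrier B" for b
    using that A by simp
  have diff: "a - c \<in> carrier ?F" if "a \<in> carrier ?F" "c \<in> carrier ?F" for a c
    using that keys_diff[of a c] by auto
  have "tensor_relators A B \<subseteq> carrier ?F"
    unfolding tensor_relators_def
    using A B by (safe; intro diff; simp add: A)
  then have sub: "subgroup (tensor_kernel A B) ?F"
    unfolding tensor_kernel_def by (rule F.generate_is_subgroup)
  have "c \<in> tensor_kernel A B" if "c \<in> carrier ?F" for c
  proof -
    have "Poly_Mapping.keys c \<subseteq> carrier A \<times> carrier B" using that by simp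
    then show ?thesis
    proof (induction c rule: frag_induction)
      case zero
      then show ?case using subgroup.one_closed[OF sub] by simp
    next
      case (one x)
      then obtain b where b: "x = (\<one>\<^bsub>A\<^esub>, b)" "b \<in> carrier B" using A by auto
      have "frag_of (\<one>\<^bsub>A\<^esub> \<otimes>\<^bsub>A\<^esub> \<one>\<^bsub>A\<^esub>, b) - frag_of (\<one>\<^bsub>A\<^esub>, b) - frag_of (\<one>\<^bsub>A\<^esub>, b) \<in> tensor_relators A B"
        unfolding tensor_relators_def using b A(1) by blast
      then have "- frag_of x \<in> tensor_kernel A B"
        unfolding tensor_kernel_def by (simp add: A(2) b(1) generate.incl)
      from subgroup.m_inv_closed[OF sub this] show ?case
        using one by simp
    next
      case (diff a b)
      have "- b \<in> tensor_kernel A B"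
        using subgroup.m_inv_closed[OF sub diff(2)] subgroup.mem_carrier[OF sub diff(2)] by simp
      then show ?case using subgroup.m_closed[OF sub diff(1), of "- b"] by simp
    qed
  qed
  then have ker: "tensor_kernel A B = carrier ?F"
    using subgroup.subset[OF sub] by blast
  have "normal (tensor_kernel A B) ?F" using sub by (rule F.subgroup_imp_normal)
  then have "group (tensor_product A B)"
    unfolding tensor_product_def by (rule normal.factorgroup_is_group)
  moreover have "carrier (tensor_product A B) \<subseteq> {carrier ?F}"
    unfolding tensor_product_def FactGroup_def ker
    using F.coset_join2[OF _ F.subgroup_self] by (auto simp: RCOSETS_def)
  ultimately show ?thesis using group.trivial_group_alt by blast
qed

section \<open>Products of trivial homotopy classes\<close>

lemma continuous_map_cube_0:
  assumes "f (\<lambda>_. undefined) \<in> topspace T"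
  shows "continuous_map (cube 0) T f"
  by (rule continuous_map_eq[of _ _ "\<lambda>_. f (\<lambda>_. undefined)"])
    (use assms in \<open>auto simp: topspace_cube\<close>)

text \<open>On the common face \<open>x 0 = 1/2\<close> both rescaled arguments lie on the boundary,
  where both maps equal \<open>e\<close>.\<close>

lemma cube_concat_cube_maps:
  assumes f: "f \<in> cube_maps T e m" and g: "g \<in> cube_maps T e m" and m: "0 < m"
  shows "cube_concat f g \<in> cube_maps T e m"
proof -
  have fc: "continuous_map (cube m) T f" and gc: "continuous_map (cube m) T g"
    and fb: "\<And>x. x \<in> cube_boundary m \<Longrightarrow> f x = e" and gb: "\<And>x. x \<in> cube_boundary m \<Longrightarrow> g x = e"
    using f g by (auto simp: cube_maps_def)
  have proj: "continuous_map (cube m) euclideanreal (\<lambda>x. x j)" if "j < m" for j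
    unfolding cube_def using continuous_map_into_fulltopology that
    by (metis (no_types) continuous_map_product_projection lessThan_iff)
  define A where "A = {x \<in> topspace (cube m). x 0 \<in> {..1/2}}"
  define B where "B = {x \<in> topspace (cube m). x 0 \<in> {1/2..}}"
  have AB: "closedin (cube m) A" "closedin (cube m) B"
    unfolding A_def B_def by (intro closedin_continuous_map_preimage[OF proj[OF m]]; simp)+
  have upd: "continuous_map (subtopology (cube m) D) (cube m) (\<lambda>x. x(0 := c * x 0 + d))"
    if D: "\<And>x. x \<in> topspace (cube m) \<Longrightarrow> x \<in> D \<Longrightarrow> c * x 0 + d \<in> {0..1}" for D and c d :: real
  proof -
    have mem: "x(0 := c * x 0 + d) \<in> topspace (cube m)" if "x \<in> topspace (cube m)" "x \<in> D" for x
      using that D[OF that] m by (auto simp: topspace_cube PiE_iff extensional_def)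
    have c: "continuous_map (subtopology (cube m) D) euclideanreal (\<lambda>x. (x(0 := c * x 0 + d)) j)" if "j < m" for j
      using proj[OF that] proj[OF m]
      by (cases "j = 0")
        (auto intro!: continuous_map_add continuous_map_real_mult_left continuous_map_from_subtopology)
    have "(x(0 := c * x 0 + d)) j \<in> {0..1}" if "j < m" "x \<in> topspace (cube m)" "x \<in> D" for j x
      using mem[OF that(2,3)] that(1) unfolding topspace_cube by (metis PiE_mem lessThan_iff)
    then have "\<forall>j\<in>{..<m}. continuous_map (subtopology (cube m) D) (top_of_set {0..1}) (\<lambda>x. (x(0 := c * x 0 + d)) j)"
      using c unfolding continuous_map_in_subtopology by (auto simp del: fun_upd_apply)
    moreover have "(\<lambda>x. x(0 := c * x 0 + d)) ` topspace (subtopology (cube m) D) \<subseteq> extensional {..<m}"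
      using mem by (auto simp: topspace_cube PiE_iff)
    ultimately show ?thesis
      using continuous_map_componentwise[of "subtopology (cube m) D" "\<lambda>_. top_of_set {0..1}" "{..<m}"]
      unfolding cube_def[of m] by blast
  qed
  have cA: "continuous_map (subtopology (cube m) A) T (\<lambda>x. f (x(0 := 2 * x 0)))"
    using continuous_map_compose[OF upd[of A 2 0] fc] by (auto simp: o_def A_def topspace_cube PiE_iff m)
  have cB: "continuous_map (subtopology (cube m) B) T (\<lambda>x. g (x(0 := 2 * x 0 - 1)))"
    using continuous_map_compose[OF upd[of B 2 "- 1"] gc] m by (auto simp: o_def B_def topspace_cube PiE_iff)
  have half: "f (x(0 := 2 * x 0)) = g (x(0 := 2 * x 0 - 1))" if x: "x \<in> A" "x \<in> B" for x
  proof -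
    have x0: "x 0 = 1/2" and xc: "x \<in> topspace (cube m)" using x by (auto simp: A_def B_def)
    have "x(0 := 1) \<in> cube_boundary m" "x(0 := 0) \<in> cube_boundary m"
      using xc m by (auto simp: cube_boundary_def topspace_cube PiE_iff extensional_def)
    then show ?thesis using fb gb by (simp add: x0)
  qed
  have "continuous_map (cube m) T (\<lambda>x. if x \<in> A then f (x(0 := 2 * x 0)) else g (x(0 := 2 * x 0 - 1)))"
    by (rule continuous_map_paste_closed[OF AB _ cA cB half]) (auto simp: A_def B_def)
  then have "continuous_map (cube m) T (cube_concat f g)"
    by (rule continuous_map_eq) (auto simp: cube_concat_def A_def)
  moreover have "cube_concat f g x = e" if x: "x \<in> cube_boundary m" for x
  proof -
    obtain j where j: "j < m" "x j = 0 \<or> x j = 1" and xc: "x \<in> topspace (cube m)"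
      using x by (auto simp: cube_boundary_def)
    have x0: "0 \<le> x 0" "x 0 \<le> 1" using xc m by (auto simp: topspace_cube PiE_iff)
    \<comment> \<open>A face in a coordinate other than 0 survives the update. For
      \<open>j = 0\<close> the lower half contains only the end 0 and the upper half only the end 1,
      and each is sent to itself.\<close>
    have c: "x(0 := s) \<in> cube_boundary m" if "0 \<le> s" "s \<le> 1" "j = 0 \<Longrightarrow> s = 0 \<or> s = 1" for s
    proof -
      have "x(0 := s) \<in> topspace (cube m)"
        using xc m that by (auto simp: topspace_cube PiE_iff extensional_def)
      moreover have "(x(0 := s)) j = 0 \<or> (x(0 := s)) j = 1" using that j by auto
      ultimately show ?thesis using j(1) unfolding cube_boundary_def by blast
    qed
    show ?thesis
    proof (cases "x 0 \<le> 1/2")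
      case True
      then have "x(0 := 2 * x 0) \<in> cube_boundary m" using x0 j by (intro c) auto
      then show ?thesis using fb True by (simp add: cube_concat_def)
    next
      case False
      then have "x(0 := 2 * x 0 - 1) \<in> cube_boundary m" using x0 j by (intro c) auto
      then show ?thesis using gb False by (simp add: cube_concat_def)
    qed
  qed
  ultimately show ?thesis by (simp add: cube_maps_def)
qed

text \<open>The product in \<open>group_pi\<close> is a union over all representatives. Members of
  the trivial class are cube maps, their products are cube maps, and by \<open>null\<close> all of
  these form one class.\<close>

lemma trivial_rational_group_pi:
  assumes null: "\<And>f. f \<in> cube_maps T \<one>\<^bsub>G\<^esub> m \<Longrightarrow> cube_homotopic T \<one>\<^bsub>G\<^esub> m (\<lambda>_. \<one>\<^bsub>G\<^esub>) f"
    and one: "\<one>\<^bsub>G\<^esub> \<in> topspace T"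
    and mult: "\<And>a b. a \<in> topspace T \<Longrightarrow> b \<in> topspace T \<Longrightarrow> a \<otimes>\<^bsub>G\<^esub> b \<in> topspace T"
  shows "trivial_group (tensor_product (group_pi G T m) rat_group)"
proof (rule tensor_product_trivial)
  let ?c = "cube_class T \<one>\<^bsub>G\<^esub> m (\<lambda>_. \<one>\<^bsub>G\<^esub>)"
  have const: "(\<lambda>_. \<one>\<^bsub>G\<^esub>) \<in> cube_maps T \<one>\<^bsub>G\<^esub> m" using one by (simp add: cube_maps_def)
  have cls: "cube_class T \<one>\<^bsub>G\<^esub> m f = ?c" if "f \<in> cube_maps T \<one>\<^bsub>G\<^esub> m" for f
    using cube_class_eqI[OF null[OF that]] by simp
  show "carrier (group_pi G T m) = {\<one>\<^bsub>group_pi G T m\<^esub>}"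
    unfolding carrier_group_pi one_group_pi using cls const by blast
  have c_maps: "f \<in> cube_maps T \<one>\<^bsub>G\<^esub> m" if "f \<in> ?c" for f
    using that homotopic_with_imp_continuous_maps homotopic_with_imp_property
    unfolding cube_class_def cube_homotopic_def cube_maps_def by blast
  have const_c: "(\<lambda>_. \<one>\<^bsub>G\<^esub>) \<in> ?c" using null[OF const] by (simp add: cube_class_def)
  have Un: "(\<Union>f\<in>?c. \<Union>g\<in>?c. cube_class T \<one>\<^bsub>G\<^esub> m (h f g)) = ?c"
    if h: "\<And>f g. f \<in> cube_maps T \<one>\<^bsub>G\<^esub> m \<Longrightarrow> g \<in> cube_maps T \<one>\<^bsub>G\<^esub> m \<Longrightarrow> h f g \<in> cube_maps T \<one>\<^bsub>G\<^esub> m" for h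
  proof -
    have "cube_class T \<one>\<^bsub>G\<^esub> m (h f g) = ?c" if "f \<in> ?c" "g \<in> ?c" for f g
      using cls h c_maps that by blast
    then show ?thesis using const_c by (auto simp: set_eq_iff)
  qed
  show "\<one>\<^bsub>group_pi G T m\<^esub> \<otimes>\<^bsub>group_pi G T m\<^esub> \<one>\<^bsub>group_pi G T m\<^esub> = \<one>\<^bsub>group_pi G T m\<^esub>"
  proof (cases "m = 0")
    case True
    have "(\<lambda>x. f x \<otimes>\<^bsub>G\<^esub> g x) \<in> cube_maps T \<one>\<^bsub>G\<^esub> m"
      if fg: "f \<in> cube_maps T \<one>\<^bsub>G\<^esub> m" "g \<in> cube_maps T \<one>\<^bsub>G\<^esub> m" for f g
    proof -
      \<comment> \<open>The only point of the 0-dimensional cube, whose boundary is empty.\<close>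
      have "(\<lambda>_. undefined) \<in> topspace (cube m)" by (simp add: True topspace_cube)
      then have "f (\<lambda>_. undefined) \<in> topspace T" "g (\<lambda>_. undefined) \<in> topspace T"
        using fg continuous_map_image_subset_topspace unfolding cube_maps_def by blast+
      then have "continuous_map (cube 0) T (\<lambda>x. f x \<otimes>\<^bsub>G\<^esub> g x)"
        by (intro continuous_map_cube_0 mult)
      then show ?thesis by (simp add: cube_maps_def True cube_boundary_def)
    qed
    from Un[OF this] show ?thesis using True unfolding one_group_pi by (simp add: group_pi_def)
  next
    case False
    have "cube_concat f g \<in> cube_maps T \<one>\<^bsub>G\<^esub> m"
      if "f \<in> cube_maps T \<one>\<^bsub>G\<^esub> m" "g \<in> cube_maps T \<one>\<^bsub>G\<^esub> m" for f g
      using cube_concat_cube_maps[OF that] False by simp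
    from Un[OF this] show ?thesis using False unfolding one_group_pi by (simp add: group_pi_def homotopy_group_def)
  qed
  show "b \<otimes>\<^bsub>rat_group\<^esub> b' \<in> carrier rat_group" for b b' by (simp add: rat_group_def)
qed

section \<open>The compact-open topology\<close>

text \<open>The subbasic set given by the empty compact set imposes no condition, so every
  continuous extensional map occurs.\<close>

lemma topspace_compact_open:
  "f \<in> topspace (compact_open_topology X Y) \<longleftrightarrow> f \<in> extensional (topspace X) \<and> continuous_map X Y f"
proof -
  have "\<exists>S. S \<in> {{f \<in> extensional (topspace X). continuous_map X Y f \<and> f ` K \<subseteq> U} |K U.
      compactin X K \<and> openin Y U} \<and> f \<in> S" if "f \<in> extensional (topspace X)" "continuous_map X Y f"
  proof (intro exI conjI)
    show "{f \<in> extensional (topspace X). continuous_map X Y f \<and> f ` {} \<subseteq> {}} \<in>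
        {{f \<in> extensional (topspace X). continuous_map X Y f \<and> f ` K \<subseteq> U} |K U. compactin X K \<and> openin Y U}"
      by blast
  qed (use that in auto)
  then show ?thesis
    unfolding compact_open_topology_def topology_generated_by_topspace by blast
qed

text \<open>For compact \<open>K\<close> the tube lemma shows that the parameters \<open>y\<close>
  sending \<open>K\<close> into a given open set form an open set.\<close>

lemma continuous_map_curry:
  assumes h: "continuous_map (prod_topology Y X) Z (\<lambda>(y, x). h y x)"
    and ext: "\<And>y. y \<in> topspace Y \<Longrightarrow> h y \<in> extensional (topspace X)"
  shows "continuous_map Y (compact_open_topology X Z) h"
proof -
  have hy: "continuous_map X Z (h y)" if "y \<in> topspace Y" for y
    using continuous_map_compose[OF continuous_map_pairedI h, of X "\<lambda>_. y" "\<lambda>x. x"] that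
    by (simp add: o_def)
  show ?thesis
    unfolding compact_open_topology_def
  proof (rule continuous_on_generated_topo)
    show "h ` topspace Y \<subseteq> \<Union> {{f \<in> extensional (topspace X). continuous_map X Z f \<and> f ` K \<subseteq> U} |K U.
        compactin X K \<and> openin Z U}"
      using topspace_compact_open[of _ X Z] hy ext
      unfolding compact_open_topology_def topology_generated_by_topspace by blast
    fix S assume "S \<in> {{f \<in> extensional (topspace X). continuous_map X Z f \<and> f ` K \<subseteq> U} |K U.
        compactin X K \<and> openin Z U}"
    then obtain K U where S: "S = {f \<in> extensional (topspace X). continuous_map X Z f \<and> f ` K \<subseteq> U}"
      and K: "compactin X K" and U: "openin Z U" by blast
    define W where "W = {p \<in> topspace (prod_topology Y X). (case p of (y, x) \<Rightarrow> h y x) \<in> U}"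
    have W: "openin (prod_topology Y X) W"
      unfolding W_def by (rule openin_continuous_map_preimage[OF h U])
    have KX: "K \<subseteq> topspace X" using K by (rule compactin_subset_topspace)
    have eq: "h -` S \<inter> topspace Y = {y \<in> topspace Y. {y} \<times> K \<subseteq> W}"
      using hy ext KX by (auto simp: S W_def image_subset_iff)
    have "\<exists>V. openin Y V \<and> y \<in> V \<and> V \<subseteq> {y \<in> topspace Y. {y} \<times> K \<subseteq> W}"
      if y: "y \<in> topspace Y" "{y} \<times> K \<subseteq> W" for y
    proof -
      obtain V V' where V: "openin Y V" "y \<in> V" "K \<subseteq> V'" "V \<times> V' \<subseteq> W"
        using tube_lemma_right[OF W K y] by blast
      then have "V \<subseteq> {y \<in> topspace Y. {y} \<times> K \<subseteq> W}" using openin_subset by fastforce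
      then show ?thesis using V by blast
    qed
    then show "openin Y (h -` S \<inter> topspace Y)"
      unfolding eq by (subst openin_subopen) blast
  qed
qed

text \<open>Evaluation is continuous for the compact-open topology over a locally compact source,
  but the total space \<open>P\<close> need not be one, its fibre being an arbitrary topological
  group. Evaluating only along a section moves the compact neighbourhoods to the base.\<close>

lemma continuous_map_uncurry_section:
  assumes nb: "neighbourhood_base_of (compactin X) X" and U: "openin X U"
    and \<sigma>: "continuous_map (subtopology X U) P \<sigma>"
    and f: "continuous_map Y (compact_open_topology P Q) f"
  shows "continuous_map (prod_topology Y (subtopology X U)) Q (\<lambda>(y, x). f y (\<sigma> x))"
proof -
  have topU: "topspace (subtopology X U) = U" using openin_subset[OF U] by auto
  have fy: "continuous_map P Q (f y)" if "y \<in> topspace Y" for y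
    using continuous_map_image_subset_topspace[OF f] that topspace_compact_open by blast
  have f\<sigma>: "continuous_map (subtopology X U) Q (\<lambda>x. f y (\<sigma> x))" if "y \<in> topspace Y" for y
    using continuous_map_compose[OF \<sigma> fy[OF that]] by (simp add: o_def)
  show ?thesis
    unfolding continuous_map_def
  proof (intro conjI allI impI)
    show "(\<lambda>(y, x). f y (\<sigma> x)) \<in> topspace (prod_topology Y (subtopology X U)) \<rightarrow> topspace Q"
      using continuous_map_image_subset_topspace[OF f\<sigma>] by force
    fix W assume W: "openin Q W"
    let ?D = "{p \<in> topspace (prod_topology Y (subtopology X U)). (case p of (y, x) \<Rightarrow> f y (\<sigma> x)) \<in> W}"
    have "\<exists>N. openin (prod_topology Y (subtopology X U)) N \<and> p \<in> N \<and> N \<subseteq> ?D" if p: "p \<in> ?D" for p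
    proof -
      obtain y x where p': "p = (y, x)" and y: "y \<in> topspace Y" and x: "x \<in> U" "f y (\<sigma> x) \<in> W"
        using p topU by auto
      define E where "E = {x \<in> topspace (subtopology X U). f y (\<sigma> x) \<in> W}"
      have "openin (subtopology X U) E"
        unfolding E_def by (rule openin_continuous_map_preimage[OF f\<sigma>[OF y] W])
      then have E: "openin X E" using U openin_open_subtopology by blast
      have "x \<in> E" using x topU by (simp add: E_def)
      then obtain V K where V: "openin X V" "compactin X K" "x \<in> V" "V \<subseteq> K" "K \<subseteq> E"
        using nb E unfolding neighbourhood_base_of by metis
      have "compactin (subtopology X U) K"
        using V by (auto simp: compactin_subtopology E_def)
      then have K: "compactin P (\<sigma> ` K)" using \<sigma> image_compactin by blast
      define S where "S = {g \<in> extensional (topspace P). continuous_map P Q g \<and> g ` (\<sigma> ` K) \<subseteq> W}"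
      have "openin (compact_open_topology P Q) S"
        unfolding compact_open_topology_def S_def
        by (rule topology_generated_by_Basis) (use K W in blast)
      then have N: "openin Y {y \<in> topspace Y. f y \<in> S}"
        by (rule openin_continuous_map_preimage[OF f])
      have fS: "f y \<in> S"
        using continuous_map_image_subset_topspace[OF f] y topspace_compact_open[of "f y" P Q] V(5)
        by (auto simp: S_def E_def)
      have "V \<subseteq> U" using V topU by (auto simp: E_def)
      then have VU: "openin (subtopology X U) V"
        using V(1) by (simp add: openin_open_subtopology[OF U])
      have "{y \<in> topspace Y. f y \<in> S} \<times> V \<subseteq> ?D"
      proof
        fix q assume "q \<in> {y \<in> topspace Y. f y \<in> S} \<times> V"
        then obtain a b where q: "q = (a, b)" "a \<in> topspace Y" "f a \<in> S" "b \<in> V" by auto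
        then have "\<sigma> b \<in> \<sigma> ` K" using V(4) by auto
        then have "f a (\<sigma> b) \<in> W" using q(3) by (auto simp: S_def)
        then show "q \<in> ?D" using q \<open>V \<subseteq> U\<close> topU by auto
      qed
      then show ?thesis
        using N y V(3) fS VU by (intro exI[of _ "{y \<in> topspace Y. f y \<in> S} \<times> V"])
          (simp add: p' openin_prod_Times_iff)
    qed
    then show "openin (prod_topology Y (subtopology X U)) ?D"
      by (subst openin_subopen) blast
  qed
qed

text \<open>Closed chart cubes are compact neighbourhoods; in a Hausdorff space one at each point
  yields a base of them.\<close>

lemma manifold_neighbourhood_base_compactin:
  assumes "topological_manifold n X"
  shows "neighbourhood_base_of (compactin X) X"
proof -
  have H: "Hausdorff_space X" using assms by (simp add: topological_manifold_def)
  have "\<exists>U K. openin X U \<and> compactin X K \<and> x \<in> U \<and> U \<subseteq> K" if x: "x \<in> topspace X" for x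
  proof -
    obtain \<phi> where \<phi>: "chart_box n X \<phi>" "x = \<phi> (\<lambda>j. of_bool (j < n) / 2)"
      using manifold_chart_box[OF assms x] by blast
    have "(\<lambda>j. of_bool (j < n) / 2) \<in> open_unit_box n"
      by (auto simp: open_unit_box_def unit_box_def)
    then have "x \<in> \<phi> ` open_unit_box n" using \<phi>(2) by blast
    moreover have "\<phi> ` open_unit_box n \<subseteq> \<phi> ` unit_box n" by (auto simp: open_unit_box_def)
    moreover have "openin X (\<phi> ` open_unit_box n)" using \<phi>(1) by (simp add: chart_box_def)
    ultimately show ?thesis using chart_box_closedin(2)[OF H \<phi>(1) subset_refl closed_unit_box] by blast
  qed
  then have "locally_compact_space X" unfolding locally_compact_space_def by blast
  then show ?thesis using locally_compact_space_neighbourhood_base H by blast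
qed

section \<open>Gauge transformations of principal bundles\<close>

text \<open>The translation function of a principal bundle, well defined on pairs in one fibre
  because the action is free and transitive there.\<close>

definition division :: "'g monoid \<Rightarrow> ('p \<Rightarrow> 'g \<Rightarrow> 'p) \<Rightarrow> 'p \<Rightarrow> 'p \<Rightarrow> 'g" where
  "division G act p q = (THE g. g \<in> carrier G \<and> act p g = q)"

section \<open>Fibres and gauge transformations of a principal bundle\<close>

locale fiber_bundle_action =
  fixes G :: "'g monoid" (structure) and T :: "'g topology" and P :: "'p topology" and X :: "'x topology"
    and \<pi> :: "'p \<Rightarrow> 'x" and act :: "'p \<Rightarrow> 'g \<Rightarrow> 'p"
  assumes principal: "principal_bundle G T P X \<pi> act"
begin

lemma topological_group: "topological_group G T"
  using principal by (simp add: principal_bundle_def)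

sublocale group G
  using topological_group by (simp add: topological_group_def)

lemma topspace_group: "topspace T = carrier G"
  using topological_group by (simp add: topological_group_def)

lemma continuous_proj: "continuous_map P X \<pi>"
  and continuous_act: "continuous_map (prod_topology P T) P (\<lambda>(p, g). act p g)"
  and act_one: "p \<in> topspace P \<Longrightarrow> act p \<one> = p"
  and act_act: "p \<in> topspace P \<Longrightarrow> g \<in> carrier G \<Longrightarrow> h \<in> carrier G \<Longrightarrow> act (act p g) h = act p (g \<otimes> h)"
  and proj_act: "p \<in> topspace P \<Longrightarrow> g \<in> carrier G \<Longrightarrow> \<pi> (act p g) = \<pi> p"
  using principal by (auto simp: principal_bundle_def)

lemma proj_closed: "p \<in> topspace P \<Longrightarrow> \<pi> p \<in> topspace X"
  using continuous_map_image_subset_topspace[OF continuous_proj] by blast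

lemma act_closed: "p \<in> topspace P \<Longrightarrow> g \<in> carrier G \<Longrightarrow> act p g \<in> topspace P"
  using continuous_map_image_subset_topspace[OF continuous_act]
  by (simp add: topspace_group image_subset_iff)

definition trivialization :: "'x set \<Rightarrow> ('x \<times> 'g \<Rightarrow> 'p) \<Rightarrow> bool" where
  "trivialization U \<phi> \<longleftrightarrow> openin X U \<and>
     homeomorphic_map (prod_topology (subtopology X U) T) (subtopology P {p \<in> topspace P. \<pi> p \<in> U}) \<phi> \<and>
     (\<forall>u\<in>U. \<forall>g\<in>carrier G. \<pi> (\<phi> (u, g)) = u \<and>
       (\<forall>h\<in>carrier G. act (\<phi> (u, g)) h = \<phi> (u, g \<otimes> h)))"

lemma trivialization:
  assumes "trivialization U \<phi>"
  shows "openin X U"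
    "homeomorphic_map (prod_topology (subtopology X U) T) (subtopology P {p \<in> topspace P. \<pi> p \<in> U}) \<phi>"
    "\<And>u g. u \<in> U \<Longrightarrow> g \<in> carrier G \<Longrightarrow> \<pi> (\<phi> (u, g)) = u"
    "\<And>u g h. u \<in> U \<Longrightarrow> g \<in> carrier G \<Longrightarrow> h \<in> carrier G \<Longrightarrow> act (\<phi> (u, g)) h = \<phi> (u, g \<otimes> h)"
  using assms by (simp_all add: trivialization_def)

lemma trivialization_bij:
  assumes "trivialization U \<phi>"
  shows "\<And>u g. u \<in> U \<Longrightarrow> g \<in> carrier G \<Longrightarrow> \<phi> (u, g) \<in> topspace P"
    "\<And>p. p \<in> topspace P \<Longrightarrow> \<pi> p \<in> U \<Longrightarrow> \<exists>g\<in>carrier G. p = \<phi> (\<pi> p, g)"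
    "inj_on \<phi> (U \<times> carrier G)"
proof -
  note U = trivialization(1)[OF assms] and h = trivialization(2)[OF assms]
    and \<phi> = trivialization(3)[OF assms]
  have top: "topspace (prod_topology (subtopology X U) T) = U \<times> carrier G"
    using openin_subset[OF U] by (auto simp: topspace_group)
  have im: "\<phi> ` (U \<times> carrier G) = {p \<in> topspace P. \<pi> p \<in> U}"
    using homeomorphic_imp_surjective_map[OF h] unfolding top by auto
  show "\<phi> (u, g) \<in> topspace P" if "u \<in> U" "g \<in> carrier G" for u g
    using im that by blast
  show "\<exists>g\<in>carrier G. p = \<phi> (\<pi> p, g)" if p: "p \<in> topspace P" "\<pi> p \<in> U" for p
  proof -
    have "p \<in> \<phi> ` (U \<times> carrier G)" using p unfolding im by simp
    then obtain u g where "u \<in> U" "g \<in> carrier G" "p = \<phi> (u, g)" by auto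
    then show ?thesis using \<phi> by auto
  qed
  show "inj_on \<phi> (U \<times> carrier G)"
    using homeomorphic_imp_injective_map[OF h] unfolding top .
qed

lemma local_trivialization:
  assumes "x \<in> topspace X"
  obtains U \<phi> where "x \<in> U" "trivialization U \<phi>"
proof -
  have "\<forall>x\<in>topspace X. \<exists>U \<phi>. openin X U \<and> x \<in> U \<and>
        homeomorphic_map (prod_topology (subtopology X U) T)
          (subtopology P {p \<in> topspace P. \<pi> p \<in> U}) \<phi> \<and>
        (\<forall>u\<in>U. \<forall>g\<in>carrier G. \<pi> (\<phi> (u, g)) = u \<and>
           (\<forall>h\<in>carrier G. act (\<phi> (u, g)) h = \<phi> (u, g \<otimes> h)))"
    using principal unfolding principal_bundle_def by (elim conjE)
  from bspec[OF this assms] show ?thesis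
    unfolding trivialization_def[symmetric] using that by (auto simp: trivialization_def)
qed

lemma fiber_transitive:
  assumes p: "p \<in> topspace P" and q: "q \<in> topspace P" and pq: "\<pi> p = \<pi> q"
  shows "\<exists>g\<in>carrier G. act p g = q"
proof -
  obtain U \<phi> where "\<pi> p \<in> U" and triv: "trivialization U \<phi>"
    using local_trivialization[OF proj_closed[OF p]] by blast
  note act = trivialization(4)[OF triv] and ex = trivialization_bij(2)[OF triv]
  obtain a b where a: "a \<in> carrier G" "p = \<phi> (\<pi> p, a)" and b: "b \<in> carrier G" "q = \<phi> (\<pi> p, b)"
    using ex[OF p] ex[OF q] pq \<open>\<pi> p \<in> U\<close> by metis
  have "act p (inv a \<otimes> b) = \<phi> (\<pi> p, a \<otimes> (inv a \<otimes> b))"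
    using act[OF \<open>\<pi> p \<in> U\<close> a(1), of "inv a \<otimes> b"] a b by simp
  also have "a \<otimes> (inv a \<otimes> b) = b" using a b by (simp add: m_assoc[symmetric])
  finally show ?thesis using a b by (intro bexI[of _ "inv a \<otimes> b"]) auto
qed

lemma act_inj:
  assumes p: "p \<in> topspace P" and g: "g \<in> carrier G" "h \<in> carrier G" "act p g = act p h"
  shows "g = h"
proof -
  obtain U \<phi> where "\<pi> p \<in> U" and triv: "trivialization U \<phi>"
    using local_trivialization[OF proj_closed[OF p]] by blast
  note act = trivialization(4)[OF triv] and ex = trivialization_bij(2)[OF triv]
    and inj = trivialization_bij(3)[OF triv]
  obtain a where a: "a \<in> carrier G" "p = \<phi> (\<pi> p, a)"
    using ex[OF p \<open>\<pi> p \<in> U\<close>] by metis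
  have "\<phi> (\<pi> p, a \<otimes> g) = \<phi> (\<pi> p, a \<otimes> h)"
    using act[OF \<open>\<pi> p \<in> U\<close> a(1) g(1)] act[OF \<open>\<pi> p \<in> U\<close> a(1) g(2)] a g(3) by simp
  then have "a \<otimes> g = a \<otimes> h"
    using inj_onD[OF inj] \<open>\<pi> p \<in> U\<close> a g by (metis SigmaI m_closed prod.inject)
  then show ?thesis using a g by simp
qed

lemma division:
  assumes "p \<in> topspace P" "q \<in> topspace P" "\<pi> p = \<pi> q"
  shows "division G act p q \<in> carrier G" "act p (division G act p q) = q"
proof -
  have "\<exists>!g. g \<in> carrier G \<and> act p g = q"
    using fiber_transitive[OF assms] act_inj[OF assms(1)] by metis
  from theI'[OF this] show "division G act p q \<in> carrier G" "act p (division G act p q) = q"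
    by (simp_all add: division_def)
qed

text \<open>A set-theoretic section, with no continuity claimed. It serves to define
  \<open>gauge_map\<close>, whose continuity is then obtained from local sections.\<close>

definition point_over :: "'x \<Rightarrow> 'p" where
  "point_over x = (SOME p. p \<in> topspace P \<and> \<pi> p = x)"

lemma point_over:
  assumes "x \<in> topspace X"
  shows "point_over x \<in> topspace P" "\<pi> (point_over x) = x"
proof -
  obtain U \<phi> where "x \<in> U" and triv: "trivialization U \<phi>"
    using local_trivialization[OF assms] by blast
  then have "\<phi> (x, \<one>) \<in> topspace P \<and> \<pi> (\<phi> (x, \<one>)) = x"
    using trivialization(3)[OF triv] trivialization_bij(1)[OF triv] one_closed by blast
  then have "\<exists>p. p \<in> topspace P \<and> \<pi> p = x" by blast
  from someI_ex[OF this] show "point_over x \<in> topspace P" "\<pi> (point_over x) = x"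
    by (simp_all add: point_over_def)
qed

abbreviation "gauges \<equiv> gauge_group G P \<pi> act"
abbreviation "gauges_top \<equiv> gauge_topology G P \<pi> act"

lemma gauge_carrier_iff:
  "f \<in> carrier gauges \<longleftrightarrow> f \<in> extensional (topspace P) \<and> homeomorphic_map P P f \<and>
     (\<forall>p\<in>topspace P. \<pi> (f p) = \<pi> p \<and> (\<forall>g\<in>carrier G. f (act p g) = act (f p) g))"
  by (simp add: gauge_group_def)

lemma topspace_gauge: "topspace gauges_top = carrier gauges"
proof -
  have "carrier gauges \<subseteq> topspace (compact_open_topology P P)"
    by (auto simp: gauge_carrier_iff topspace_compact_open homeomorphic_imp_continuous_map)
  then show ?thesis by (auto simp: gauge_topology_def)
qed

lemma gauge_closed: "f \<in> carrier gauges \<Longrightarrow> p \<in> topspace P \<Longrightarrow> f p \<in> topspace P"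
  using homeomorphic_imp_surjective_map unfolding gauge_carrier_iff by blast

lemma gauge_Bij: "f \<in> carrier gauges \<Longrightarrow> f \<in> Bij (topspace P)"
  using homeomorphic_imp_surjective_map homeomorphic_imp_injective_map
  unfolding gauge_carrier_iff Bij_def bij_betw_def by blast

lemma gauge_one: "\<one>\<^bsub>gauges\<^esub> = (\<lambda>p\<in>topspace P. p)"
  by (simp add: gauge_group_def BijGroup_def)

lemma gauge_one_closed: "\<one>\<^bsub>gauges\<^esub> \<in> carrier gauges"
  unfolding gauge_carrier_iff gauge_one
proof (intro conjI ballI)
  show "homeomorphic_map P P (\<lambda>p\<in>topspace P. p)"
    by (rule homeomorphic_map_eq[of _ _ "\<lambda>p. p"]) (auto simp: homeomorphic_map_id[unfolded id_def])
qed (auto simp: act_closed)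

lemma gauge_mult_closed:
  assumes f: "f \<in> carrier gauges" and g: "g \<in> carrier gauges"
  shows "f \<otimes>\<^bsub>gauges\<^esub> g \<in> carrier gauges"
proof -
  have "f \<otimes>\<^bsub>gauges\<^esub> g = compose (topspace P) f g"
    using gauge_Bij[OF f] gauge_Bij[OF g] by (simp add: gauge_group_def BijGroup_def)
  moreover have "compose (topspace P) f g \<in> carrier gauges"
    unfolding gauge_carrier_iff
  proof (intro conjI ballI)
    have "homeomorphic_map P P (f \<circ> g)"
      using f g homeomorphic_map_compose unfolding gauge_carrier_iff by blast
    then show "homeomorphic_map P P (compose (topspace P) f g)"
      by (rule homeomorphic_map_eq) (simp add: compose_def)
  qed (use f g gauge_closed[OF g] act_closed in \<open>auto simp: gauge_carrier_iff compose_def\<close>)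
  ultimately show ?thesis by simp
qed

lemma continuous_map_act:
  assumes "continuous_map Y P f" "continuous_map Y T g"
  shows "continuous_map Y P (\<lambda>y. act (f y) (g y))"
  using continuous_map_compose[OF continuous_map_pairedI[OF assms] continuous_act] by (simp add: o_def)

end

section \<open>Abelian structure group: gauge transformations as maps to the group\<close>

locale abelian_bundle_action = fiber_bundle_action G T P X \<pi> act
  for G :: "'g monoid" (structure) and T :: "'g topology" and P :: "'p topology" and X :: "'x topology"
    and \<pi> :: "'p \<Rightarrow> 'x" and act :: "'p \<Rightarrow> 'g \<Rightarrow> 'p" +
  assumes commutative: "comm_group G"
begin

sublocale comm_group G by (rule commutative)

text \<open>Equivariance amounts to commuting \<open>g\<close> past
  \<open>\<gamma> (\<pi> p)\<close>, which is where the abelian structure group enters; the inverse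
  translates by the inverse map.\<close>

lemma gauge_of_map:
  assumes \<gamma>: "continuous_map X T \<gamma>"
  shows "(\<lambda>p\<in>topspace P. act p (\<gamma> (\<pi> p))) \<in> carrier gauges"
proof -
  have \<gamma>G: "\<gamma> x \<in> carrier G" if "x \<in> topspace X" for x
    using continuous_map_image_subset_topspace[OF \<gamma>] that topspace_group by blast
  have \<gamma>\<pi>: "continuous_map P T (\<lambda>p. \<gamma> (\<pi> p))"
    using continuous_map_compose[OF continuous_proj \<gamma>] by (simp add: o_def)
  define f where "f p = act p (\<gamma> (\<pi> p))" for p
  define f' where "f' p = act p (inv (\<gamma> (\<pi> p)))" for p
  have "continuous_map P P f" "continuous_map P P f'"
    unfolding f_def f'_def using continuous_map_id[of P, unfolded id_def]
    by (intro continuous_map_act continuous_map_group_inv[OF topological_group] \<gamma>\<pi>; simp)+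
  moreover have "f' (f p) = p \<and> f (f' p) = p" if "p \<in> topspace P" for p
    using that \<gamma>G[OF proj_closed[OF that]]
    by (simp add: f_def f'_def proj_act act_act act_one)
  ultimately have "homeomorphic_maps P P f f'" by (simp add: homeomorphic_maps_def)
  then have "homeomorphic_map P P f" by (rule homeomorphic_maps_imp_map)
  then have "homeomorphic_map P P (restrict f (topspace P))"
    by (rule homeomorphic_map_eq) simp
  moreover have "f (act p g) = act (f p) g" if "p \<in> topspace P" "g \<in> carrier G" for p g
    using that \<gamma>G[OF proj_closed[OF that(1)]]
    by (simp add: f_def proj_act act_act m_comm)
  moreover have "\<pi> (f p) = \<pi> p" if "p \<in> topspace P" for p
    using that \<gamma>G[OF proj_closed[OF that]] by (simp add: f_def proj_act)
  ultimately have "restrict f (topspace P) \<in> carrier gauges"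
    by (simp add: gauge_carrier_iff act_closed)
  then show ?thesis unfolding f_def[abs_def] .
qed

definition gauge_map :: "('p \<Rightarrow> 'p) \<Rightarrow> 'x \<Rightarrow> 'g" where
  "gauge_map f x = division G act (point_over x) (f (point_over x))"

text \<open>Moving the reference point by \<open>a\<close> conjugates the translating element by
  \<open>a\<close>, so in an abelian group it depends only on the base point.\<close>

lemma gauge_map:
  assumes f: "f \<in> carrier gauges" and p: "p \<in> topspace P"
  shows "gauge_map f (\<pi> p) \<in> carrier G" "act p (gauge_map f (\<pi> p)) = f p"
proof -
  let ?q = "point_over (\<pi> p)"
  have q: "?q \<in> topspace P" "\<pi> ?q = \<pi> p" using point_over[OF proj_closed[OF p]] by auto
  have fq: "f ?q \<in> topspace P" "\<pi> ?q = \<pi> (f ?q)"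
    using f q gauge_closed[OF f q(1)] by (auto simp: gauge_carrier_iff)
  show g: "gauge_map f (\<pi> p) \<in> carrier G"
    unfolding gauge_map_def by (rule division(1)[OF q(1) fq])
  have e: "act ?q (gauge_map f (\<pi> p)) = f ?q"
    unfolding gauge_map_def by (rule division(2)[OF q(1) fq])
  obtain a where a: "a \<in> carrier G" "act ?q a = p" using fiber_transitive[OF q(1) p q(2)] by blast
  have "act p (gauge_map f (\<pi> p)) = act ?q (a \<otimes> gauge_map f (\<pi> p))"
    using a g q(1) act_act by metis
  also have "\<dots> = act (f ?q) a"
    using a g q(1) e act_act m_comm by metis
  also have "\<dots> = f p"
    using f a q(1) unfolding gauge_carrier_iff by metis
  finally show "act p (gauge_map f (\<pi> p)) = f p" .
qed

lemma gauge_map_eqI: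
  assumes "f \<in> carrier gauges" "p \<in> topspace P" "g \<in> carrier G" "f p = act p g"
  shows "gauge_map f (\<pi> p) = g"
  using gauge_map[OF assms(1,2)] act_inj[OF assms(2)] assms(3,4) by metis

text \<open>In a trivialization, \<open>f y\<close> applied to the unit section has
  \<open>gauge_map (f y)\<close> as its group coordinate, so continuity of evaluation along that
  section suffices; the local statements paste over an open cover of \<open>X\<close>.\<close>

lemma continuous_map_gauge_map:
  assumes nb: "neighbourhood_base_of (compactin X) X"
    and f: "continuous_map Y gauges_top f"
  shows "continuous_map (prod_topology Y X) T (\<lambda>(y, x). gauge_map (f y) x)"
proof -
  have fg: "f y \<in> carrier gauges" if "y \<in> topspace Y" for y
    using continuous_map_image_subset_topspace[OF f] that topspace_gauge by blast
  have fc: "continuous_map Y (compact_open_topology P P) f"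
    using f continuous_map_into_fulltopology unfolding gauge_topology_def by blast
  have loc: "\<exists>U. openin X U \<and> x \<in> U \<and>
      continuous_map (prod_topology Y (subtopology X U)) T (\<lambda>(y, x). gauge_map (f y) x)"
    if x: "x \<in> topspace X" for x
  proof -
    obtain U \<phi> where "x \<in> U" and triv: "trivialization U \<phi>"
      using local_trivialization[OF x] by blast
    then have U: "openin X U" "x \<in> U" using trivialization(1) by blast+
    note h = trivialization(2)[OF triv] and \<pi>\<phi> = trivialization(3)[OF triv]
      and act\<phi> = trivialization(4)[OF triv] and \<phi>P = trivialization_bij(1)[OF triv]
    have topU: "topspace (subtopology X U) = U" using openin_subset[OF U(1)] by auto
    obtain \<psi> where \<psi>: "homeomorphic_maps (prod_topology (subtopology X U) T)
        (subtopology P {p \<in> topspace P. \<pi> p \<in> U}) \<phi> \<psi>"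
      using h unfolding homeomorphic_map_maps by blast
    have \<psi>c: "continuous_map (subtopology P {p \<in> topspace P. \<pi> p \<in> U}) (prod_topology (subtopology X U) T) \<psi>"
      using \<psi> by (simp add: homeomorphic_maps_def)
    have \<psi>\<phi>: "\<psi> (\<phi> (u, g)) = (u, g)" if "u \<in> U" "g \<in> carrier G" for u g
      using \<psi> that topU topspace_group unfolding homeomorphic_maps_def by auto
    define \<sigma> where "\<sigma> u = \<phi> (u, \<one>)" for u
    have "continuous_map (subtopology X U) (prod_topology (subtopology X U) T) (\<lambda>u. (u, \<one>))"
      by (intro continuous_map_pairedI) (auto simp: topspace_group)
    from continuous_map_compose[OF this homeomorphic_imp_continuous_map[OF h]]
    have \<sigma>: "continuous_map (subtopology X U) P \<sigma>"
      using continuous_map_into_fulltopology by (auto simp: o_def \<sigma>_def[abs_def])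
    have \<sigma>P: "\<sigma> u \<in> topspace P" "\<pi> (\<sigma> u) = u" if "u \<in> U" for u
      using \<phi>P \<pi>\<phi> that by (auto simp: \<sigma>_def)
    have f\<sigma>: "f y (\<sigma> u) = \<phi> (u, gauge_map (f y) u)" "gauge_map (f y) u \<in> carrier G"
      if "y \<in> topspace Y" "u \<in> U" for y u
    proof -
      show g: "gauge_map (f y) u \<in> carrier G"
        using gauge_map(1)[OF fg[OF that(1)] \<sigma>P(1)[OF that(2)]] \<sigma>P(2)[OF that(2)] by simp
      have "f y (\<sigma> u) = act (\<sigma> u) (gauge_map (f y) u)"
        using gauge_map(2)[OF fg[OF that(1)] \<sigma>P(1)[OF that(2)]] \<sigma>P(2)[OF that(2)] by simp
      then show "f y (\<sigma> u) = \<phi> (u, gauge_map (f y) u)"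
        using act\<phi>[OF that(2) one_closed g] g by (simp add: \<sigma>_def)
    qed
    have "continuous_map (prod_topology Y (subtopology X U)) P (\<lambda>(y, u). f y (\<sigma> u))"
      by (rule continuous_map_uncurry_section[OF nb U(1) \<sigma> fc])
    then have "continuous_map (prod_topology Y (subtopology X U)) (subtopology P {p \<in> topspace P. \<pi> p \<in> U})
        (\<lambda>(y, u). f y (\<sigma> u))"
      using f\<sigma> \<phi>P \<pi>\<phi> topU by (auto simp: continuous_map_in_subtopology)
    from continuous_map_compose[OF continuous_map_compose[OF this \<psi>c] continuous_map_snd]
    have "continuous_map (prod_topology Y (subtopology X U)) T (snd \<circ> (\<psi> \<circ> (\<lambda>(y, u). f y (\<sigma> u))))" .
    then have "continuous_map (prod_topology Y (subtopology X U)) T (\<lambda>(y, u). gauge_map (f y) u)"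
      by (rule continuous_map_eq) (use f\<sigma> \<psi>\<phi> topU in auto)
    then show ?thesis using U by blast
  qed
  show ?thesis
  proof (rule pasting_lemma[where I = "{U. openin X U \<and>
        continuous_map (prod_topology Y (subtopology X U)) T (\<lambda>(y, x). gauge_map (f y) x)}"
        and T = "\<lambda>U. topspace Y \<times> U" and f = "\<lambda>_ (y, x). gauge_map (f y) x"])
    show "openin (prod_topology Y X) (topspace Y \<times> U)" if "U \<in> {U. openin X U \<and>
        continuous_map (prod_topology Y (subtopology X U)) T (\<lambda>(y, x). gauge_map (f y) x)}" for U
      using that by (simp add: openin_prod_Times_iff)
    show "continuous_map (subtopology (prod_topology Y X) (topspace Y \<times> U)) T (\<lambda>(y, x). gauge_map (f y) x)"
      if "U \<in> {U. openin X U \<and>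
        continuous_map (prod_topology Y (subtopology X U)) T (\<lambda>(y, x). gauge_map (f y) x)}" for U
      using that by (simp add: subtopology_Times)
  qed (use loc in auto)
qed

text \<open>The cube map is uncurried to \<open>F\<close>, which is contracted over
  \<open>X\<close>; letting the contraction act on \<open>P\<close> and currying it gives a homotopy
  through gauge transformations.\<close>

theorem gauge_cube_nullhomotopic:
  assumes X: "topological_manifold n X"
    and pi: "\<And>m. m \<le> i + n \<Longrightarrow> trivial_group (group_pi G T m)"
    and f: "f \<in> cube_maps gauges_top \<one>\<^bsub>gauges\<^esub> i"
  shows "cube_homotopic gauges_top \<one>\<^bsub>gauges\<^esub> i (\<lambda>_. \<one>\<^bsub>gauges\<^esub>) f"
proof -
  define I where "I = {0..1::real}"
  have fc: "continuous_map (cube i) gauges_top f"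
    and fb: "\<And>y. y \<in> cube_boundary i \<Longrightarrow> f y = \<one>\<^bsub>gauges\<^esub>"
    using f by (auto simp: cube_maps_def)
  have fg: "f y \<in> carrier gauges" if "y \<in> topspace (cube i)" for y
    using continuous_map_image_subset_topspace[OF fc] that topspace_gauge by blast
  define F where "F = (\<lambda>(y, x). gauge_map (f y) x)"
  have F: "continuous_map (prod_topology (cube i) X) T F"
    unfolding F_def
    by (rule continuous_map_gauge_map[OF manifold_neighbourhood_base_compactin[OF X] fc])
  have Fb: "F (y, x) = \<one>" if "y \<in> cube_boundary i" "x \<in> topspace X" for y x
    using gauge_map_eqI[OF gauge_one_closed point_over(1)[OF that(2)] one_closed] point_over[OF that(2)]
      fb[OF that(1)] by (simp add: F_def gauge_one act_one)
  obtain k where k: "partial_nullhomotopy i X T \<one> F (topspace X) k"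
    using manifold_nullhomotopy[OF topological_group X pi F Fb] by blast
  have kc: "continuous_map (prod_topology (prod_topology (cube i) X) (top_of_set I)) T k"
    and k0: "\<And>y x. y \<in> topspace (cube i) \<Longrightarrow> x \<in> topspace X \<Longrightarrow> k ((y, x), 0) = \<one>"
    and k1: "\<And>y x. y \<in> topspace (cube i) \<Longrightarrow> x \<in> topspace X \<Longrightarrow> k ((y, x), 1) = F (y, x)"
    and kb: "\<And>y x t. y \<in> cube_boundary i \<Longrightarrow> x \<in> topspace X \<Longrightarrow> t \<in> I \<Longrightarrow> k ((y, x), t) = \<one>"
    using k unfolding partial_nullhomotopy_def nullhomotopy_def I_def by auto
  define h where "h z = (\<lambda>p\<in>topspace P. act p (k ((fst z, \<pi> p), snd z)))" for z
  let ?Y = "prod_topology (cube i) (top_of_set I)"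
  have "continuous_map (prod_topology ?Y P) P (\<lambda>w. act (snd w) (k ((fst (fst w), \<pi> (snd w)), snd (fst w))))"
  proof (rule continuous_map_act)
    have "continuous_map (prod_topology ?Y P) (prod_topology (prod_topology (cube i) X) (top_of_set I))
        (\<lambda>w. ((fst (fst w), \<pi> (snd w)), snd (fst w)))"
      by (intro continuous_map_pairedI continuous_map_compose[OF continuous_map_fst continuous_map_fst, unfolded o_def]
          continuous_map_compose[OF continuous_map_fst continuous_map_snd, unfolded o_def]
          continuous_map_compose[OF continuous_map_snd continuous_proj, unfolded o_def])
    from continuous_map_compose[OF this kc]
    show "continuous_map (prod_topology ?Y P) T (\<lambda>w. k ((fst (fst w), \<pi> (snd w)), snd (fst w)))"
      by (simp add: o_def)
  qed (rule continuous_map_snd)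
  then have "continuous_map (prod_topology ?Y P) P (\<lambda>(z, p). h z p)"
    by (rule continuous_map_eq) (auto simp: h_def)
  then have "continuous_map ?Y (compact_open_topology P P) h"
    by (rule continuous_map_curry) (unfold h_def, rule restrict_extensional)
  moreover have "h z \<in> carrier gauges" if z: "z \<in> topspace ?Y" for z
    unfolding h_def
  proof (rule gauge_of_map)
    have "continuous_map X (prod_topology (prod_topology (cube i) X) (top_of_set I)) (\<lambda>x. ((fst z, x), snd z))"
      using z by (intro continuous_map_pairedI) auto
    from continuous_map_compose[OF this kc]
    show "continuous_map X T (\<lambda>x. k ((fst z, x), snd z))" by (simp add: o_def)
  qed
  ultimately have hc: "continuous_map ?Y gauges_top h"
    unfolding gauge_topology_def by (auto simp: continuous_map_in_subtopology)
  have "h (y, 1) = f y" if y: "y \<in> topspace (cube i)" for y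
  proof
    fix p show "h (y, 1) p = f y p"
    proof (cases "p \<in> topspace P")
      case True
      then show ?thesis
        using gauge_map(2)[OF fg[OF y] True] k1[OF y proj_closed[OF True]] by (simp add: h_def F_def)
    next
      case False
      then show ?thesis
        using fg[OF y] by (simp add: h_def gauge_carrier_iff extensional_def)
    qed
  qed
  moreover have "h (y, 0) = \<one>\<^bsub>gauges\<^esub>" if y: "y \<in> topspace (cube i)" for y
    using k0[OF y proj_closed] act_one by (auto simp: h_def gauge_one restrict_def)
  ultimately have "nullhomotopy (cube i) gauges_top \<one>\<^bsub>gauges\<^esub> f h"
    using hc by (simp add: nullhomotopy_def I_def)
  moreover have "h (y, t) = \<one>\<^bsub>gauges\<^esub>" if y: "y \<in> cube_boundary i" "t \<in> {0..1}" for y t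
    using kb[OF y(1) proj_closed, of _ t] y(2) act_one by (auto simp: h_def gauge_one restrict_def I_def)
  ultimately show ?thesis by (rule nullhomotopy_imp_cube_homotopic_const)
qed

text \<open>Degree \<open>i\<close> of the gauge group involves cells of dimension up to
  \<open>i + n\<close>, whence the shift by \<open>n\<close> in the hypothesis.\<close>

theorem rationally_connected_gauge:
  assumes "topological_manifold n X" "\<And>i. i \<le> m + n \<Longrightarrow> trivial_group (group_pi G T i)"
  shows "rationally_connected m gauges gauges_top"
  unfolding rationally_connected_def
proof (intro allI impI)
  fix i assume "i \<le> m"
  then have "trivial_group (group_pi G T j)" if "j \<le> i + n" for j using that assms(2) by simp
  then show "trivial_group (tensor_product (group_pi gauges gauges_top i) rat_group)"
    using gauge_cube_nullhomotopic[OF assms(1)] gauge_one_closed gauge_mult_closed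
    by (intro trivial_rational_group_pi) (auto simp: topspace_gauge)
qed

end

section \<open>The String, Fivebrane and Ninebrane cases\<close>

theorem corollary31:
  fixes n :: nat and X :: "'x topology"
    and G :: "'g monoid" and T :: "'g topology"
    and P :: "'p topology" and \<pi> :: "'p \<Rightarrow> 'x" and act :: "'p \<Rightarrow> 'g \<Rightarrow> 'p"
    and S :: "'s topology" and s0 :: 's
    and p :: "'s \<Rightarrow> nat \<Rightarrow> nat \<Rightarrow> real" and r :: "'s \<Rightarrow> 'g"
  assumes "topological_manifold n X"
    and "principal_bundle G T P X \<pi> act"
    and "(n \<le> 3 \<and> rational_String S s0 p r G T) \<or>
         (n \<le> 7 \<and> rational_Fivebrane S s0 p r G T) \<or>
         (n \<le> 11 \<and> rational_Ninebrane S s0 p r G T)"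
  shows "rationally_connected 3 (gauge_group G P \<pi> act) (gauge_topology G P \<pi> act)"
proof -
  \<comment> \<open>The three cases share one form: the bound on \<open>n\<close> is exactly the
    degree \<open>k\<close> up to which the homotopy of \<open>O\<close> is killed.\<close>
  obtain k where k: "n \<le> k" "rational_cover_group k S s0 p r G T"
    using assms(3) unfolding rational_String_def rational_Fivebrane_def rational_Ninebrane_def by blast
  then have "comm_group G" by (simp add: rational_cover_group_def)
  then interpret abelian_bundle_action G T P X \<pi> act
    using assms(2)
    by (intro abelian_bundle_action.intro fiber_bundle_action.intro abelian_bundle_action_axioms.intro)
  have "trivial_group (group_pi G T i)" if "i \<le> 3 + n" for i
  proof -
    \<comment> \<open>\<open>i \<le> 3 + n \<le> k + 3\<close> stays below the first nonzero degree
      \<open>k + 4\<close>.\<close>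
    have "\<not> (i mod 4 = 3 \<and> k + 4 \<le> i)" using that k(1) by simp
    then show ?thesis using k(2) unfolding rational_cover_group_def by metis
  qed
  then show ?thesis by (rule rationally_connected_gauge[OF assms(1)])
qed

end
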